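(* Let $p,q,r\ge1$ be integers and let $J_{\Gamma_{p,q,r}}\subset T$ be the toric ideal of the Rees algebra of the vertex cover ideal of the graph $\Gamma_{p,q,r}$, with $T$ and the monomial order $<$ on $T$ as defined in the context. The reduced Gröbner basis of $J_{\Gamma_{p,q,r}}$ with respect to $<$ consists of the following binomials: - $x_i\varphi_i-y_qz_1\psi_q^1$, $1\le i\le p$; - $y_j\psi_j^k-y_q\psi_q^k$, $1\le j<q$, $1\le k\le r$; - $z_k\psi_j^k-z_1\psi_j^1$, $1\le j\le q$, $1<k\le r$; - $\psi_{j_1}^{k_2}\psi_{j_2}^{k_1}-\psi_{j_1}^{k_1}\psi_{j_2}^{k_2}$, $1\le j_1<j_2\le q$, $1\le k_1<k_2\le r$. Its initial ideal $\operatorname{in}_<(J_{\Gamma_{p,q,r}})$ is generated by the following quadratic monomials: - $x_i\varphi_i$, $1\le i\le p$; - $y_j\psi_j^k$, $1\le j<q$, $1\le k\le r$; - $z_k\psi_j^k$, $1\le j\le q$, $1<k\le r$; - $\psi_{j_1}^{k_2}\psi_{j_2}^{k_1}$, $1\le j_1<j_2\le q$, $1\le k_1<k_2\le r$.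
   Context: Let $V=\{x_1,\ldots,x_p,y_1,\ldots,y_q,z_1,\ldots,z_r\}$. $\Gamma_{p,q,r}=G_{p,q}\cup G_{p,r}$ is the simple graph on $V$ that is the union of the complete graph $G_{p,q}$ on $\{x_1,\ldots,x_p,y_1,\ldots,y_q\}$ and the complete graph $G_{p,r}$ on $\{x_1,\ldots,x_p,z_1,\ldots,z_r\}$. Let $K$ be a field and $S=K[x_1,\ldots,x_p,y_1,\ldots,y_q,z_1,\ldots,z_r]$. The vertex cover ideal $I_{\Gamma_{p,q,r}}\subset S$ (generated by the products of variables over minimal vertex covers) has the generators $g_i=(\mathbf x/x_i)\mathbf y\mathbf z$ ($1\le i\le p$) and $f_j^k=\mathbf x(\mathbf y/y_j)(\mathbf z/z_k)$ ($1\le j\le q$, $1\le k\le r$), where $\mathbf x=x_1\cdots x_p$, $\mathbf y=y_1\cdots y_q$, $\mathbf z=z_1\cdots z_r$. Its Rees algebra $\mathcal R(I_{\Gamma_{p,q,r}})\subset S[t]$ is generated over $K$ by all variables of $S$, all $g_it$ and all $f_j^kt$. Let $T$ be the polynomial ring over $K$ in the variables $x_i,y_j,z_k,\varphi_i,\psi_j^k$ ($1\le i\le p$, $1\le j\le q$, $1\le k\le r$; in $\psi_j^k$ the superscript is an index), and let $\pi:T\to\mathcal R(I_{\Gamma_{p,q,r}})$ be the surjective $K$-algebra homomorphism with $\pi(x_i)=x_i$, $\pi(y_j)=y_j$, $\pi(z_k)=z_k$, $\pi(\varphi_i)=g_it$, $\pi(\psi_j^k)=f_j^kt$. $J_{\Gamma_{p,q,r}}=\operatorname{Ker}\pi$.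 Monomial order: let $<_{\rm lex}$ be the lexicographic order on $K[\{\varphi_i,\psi_j^k\}]$ induced by $\varphi_1>\cdots>\varphi_p>\psi_1^r>\psi_1^{r-1}>\cdots>\psi_1^1>\psi_2^r>\cdots>\psi_2^1>\cdots>\psi_q^r>\cdots>\psi_q^1$, and let $<'_{\rm lex}$ be the lexicographic order on $S$ induced by $y_q>\cdots>y_1>z_1>\cdots>z_r>x_p>\cdots>x_1$. For monomials $u,u'\in S$ and $w,w'\in K[\{\varphi_i,\psi_j^k\}]$, put $uw<u'w'$ iff $w<_{\rm lex}w'$, or $w=w'$ and $u<'_{\rm lex}u'$. *)

theory Defs
  imports
    "HOL-Library.Poly_Mapping"
    "HOL-Computational_Algebra.Polynomial"
    "HOL-Algebra.Generated_Rings"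
begin

hide_const (open) UnivPoly.monom UnivPoly.coeff

section \<open>Polynomial rings in finitely many variables\<close>

text \<open>
  A power product is a finitely supported exponent function, a polynomial a finitely supported
  function from power products to coefficients.  The type allows arbitrary variables; the ring
  \<open>K[V]\<close> is the structure \<open>pring V\<close>, whose carrier restricts them to \<open>V\<close>.
\<close>

type_synonym 'v mon = "'v \<Rightarrow>\<^sub>0 nat"
type_synonym ('v, 'k) mpoly = "'v mon \<Rightarrow>\<^sub>0 'k"

definition monomial :: "'v mon \<Rightarrow> ('v, 'k::field) mpoly" where
  "monomial m = Poly_Mapping.single m 1"

definition var :: "'v \<Rightarrow> ('v, 'k::field) mpoly" where
  "var v = monomial (Poly_Mapping.single v 1)"

definition const :: "'k \<Rightarrow> ('v, 'k::field) mpoly" where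
  "const c = Poly_Mapping.single 0 c"

definition ring_on :: "'a set \<Rightarrow> 'a::comm_ring_1 ring" where
  "ring_on A = \<lparr>carrier = A, monoid.mult = (*), one = 1, zero = 0, add = (+)\<rparr>"

definition pring :: "'v set \<Rightarrow> ('v, 'k::field) mpoly ring" where
  "pring V = ring_on {f. \<forall>m\<in>Poly_Mapping.keys f. Poly_Mapping.keys m \<subseteq> V}"

text \<open>The value of \<open>f\<close> when each variable \<open>v\<close> is replaced by \<open>h v\<close> and each coefficient \<open>c\<close>
  by \<open>e c\<close>.\<close>

definition subst :: "('k \<Rightarrow> 'b) \<Rightarrow> ('v \<Rightarrow> 'b) \<Rightarrow> ('v, 'k::field) mpoly \<Rightarrow> 'b::comm_ring_1" where
  "subst e h f = (\<Sum>m\<in>Poly_Mapping.keys f. e (Poly_Mapping.lookup f m) *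
     (\<Prod>v\<in>Poly_Mapping.keys m. h v ^ Poly_Mapping.lookup m v))"


section \<open>Initial ideals and reduced Groebner bases\<close>

text \<open>In this section \<open>lt\<close> is the strict part of a monomial order.\<close>

definition lead_mon :: "('v mon \<Rightarrow> 'v mon \<Rightarrow> bool) \<Rightarrow> ('v, 'k::field) mpoly \<Rightarrow> 'v mon" where
  "lead_mon lt f = (THE m. m \<in> Poly_Mapping.keys f \<and> (\<forall>m'\<in>Poly_Mapping.keys f. m' \<noteq> m \<longrightarrow> lt m' m))"

definition initial_ideal ::
  "'v set \<Rightarrow> ('v mon \<Rightarrow> 'v mon \<Rightarrow> bool) \<Rightarrow> ('v, 'k::field) mpoly set \<Rightarrow> ('v, 'k) mpoly set" where
  "initial_ideal V lt I = Idl\<^bsub>pring V\<^esub> {monomial (lead_mon lt f) | f. f \<in> I \<and> f \<noteq> 0}"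

definition groebner_basis ::
  "'v set \<Rightarrow> ('v mon \<Rightarrow> 'v mon \<Rightarrow> bool) \<Rightarrow> ('v, 'k::field) mpoly set \<Rightarrow> ('v, 'k) mpoly set \<Rightarrow> bool" where
  "groebner_basis V lt I G \<longleftrightarrow> finite G \<and> G \<subseteq> I - {0} \<and>
     initial_ideal V lt I = Idl\<^bsub>pring V\<^esub> {monomial (lead_mon lt g) | g. g \<in> G}"

definition reduced_groebner_basis ::
  "'v set \<Rightarrow> ('v mon \<Rightarrow> 'v mon \<Rightarrow> bool) \<Rightarrow> ('v, 'k::field) mpoly set \<Rightarrow> ('v, 'k) mpoly set \<Rightarrow> bool" where
  "reduced_groebner_basis V lt I G \<longleftrightarrow> groebner_basis V lt I G \<and>
     (\<forall>g\<in>G. Poly_Mapping.lookup g (lead_mon lt g) = 1) \<and>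
     (\<forall>g\<in>G. \<forall>g'\<in>G. g \<noteq> g' \<longrightarrow>
        (\<forall>m\<in>Poly_Mapping.keys g'. \<not> (\<exists>l. m = lead_mon lt g + l)))"

definition lex_less :: "('v \<Rightarrow> 'v \<Rightarrow> bool) \<Rightarrow> 'v mon \<Rightarrow> 'v mon \<Rightarrow> bool" where
  "lex_less vlt m m' \<longleftrightarrow> (\<exists>v. Poly_Mapping.lookup m v < Poly_Mapping.lookup m' v \<and>
     (\<forall>u. vlt v u \<longrightarrow> Poly_Mapping.lookup m u = Poly_Mapping.lookup m' u))"


section \<open>Vertex cover ideals and Rees algebras\<close>

text \<open>A simple graph is given by its vertex set and its set of two-element edges.\<close>

definition vertex_cover :: "'v set \<Rightarrow> 'v set set \<Rightarrow> 'v set \<Rightarrow> bool" where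
  "vertex_cover V E C \<longleftrightarrow> C \<subseteq> V \<and> (\<forall>e\<in>E. e \<inter> C \<noteq> {})"

definition minimal_vertex_cover :: "'v set \<Rightarrow> 'v set set \<Rightarrow> 'v set \<Rightarrow> bool" where
  "minimal_vertex_cover V E C \<longleftrightarrow> vertex_cover V E C \<and> (\<forall>D. D \<subset> C \<longrightarrow> \<not> vertex_cover V E D)"

definition cover_monomials :: "'v set \<Rightarrow> 'v set set \<Rightarrow> ('v, 'k::field) mpoly set" where
  "cover_monomials V E = {\<Prod>v\<in>C. var v | C. minimal_vertex_cover V E C}"

definition vertex_cover_ideal :: "'v set \<Rightarrow> 'v set set \<Rightarrow> ('v, 'k::field) mpoly set" where
  "vertex_cover_ideal V E = Idl\<^bsub>pring V\<^esub> (cover_monomials V E)"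

text \<open>\<open>S[t]\<close> for \<open>S = pring V\<close>, and the Rees algebra \<open>S[It]\<close> of an ideal \<open>I\<close> of \<open>S\<close> inside it;
  \<open>Polynomial.monom f n\<close> is \<open>f t\<^sup>n\<close>.\<close>

definition pring_t :: "'v set \<Rightarrow> ('v, 'k::field) mpoly poly ring" where
  "pring_t V = ring_on {F. \<forall>n. Polynomial.coeff F n \<in> carrier (pring V)}"

definition rees_algebra :: "'v set \<Rightarrow> ('v, 'k::field) mpoly set \<Rightarrow> ('v, 'k) mpoly poly ring" where
  "rees_algebra V I = (pring_t V)\<lparr>carrier := generate_ring (pring_t V)
     ({Polynomial.monom f 0 | f. f \<in> carrier (pring V)} \<union> {Polynomial.monom f 1 | f. f \<in> I})\<rparr>"


section \<open>The graph, the presentation of its Rees algebra, and the toric ideal\<close>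

text \<open>Variables of \<open>S\<close>, and the remaining variables of \<open>T\<close>: \<open>Psi j k\<close> has lower index \<open>j\<close> and
  upper index \<open>k\<close>.  Indices start at 1.\<close>

datatype svar = X nat | Y nat | Z nat
datatype fvar = Phi nat | Psi nat nat
type_synonym tvar = "svar + fvar"

definition svars :: "nat \<Rightarrow> nat \<Rightarrow> nat \<Rightarrow> svar set" where
  "svars p q r = X ` {1..p} \<union> Y ` {1..q} \<union> Z ` {1..r}"

definition fvars :: "nat \<Rightarrow> nat \<Rightarrow> nat \<Rightarrow> fvar set" where
  "fvars p q r = Phi ` {1..p} \<union> {Psi j k | j k. j \<in> {1..q} \<and> k \<in> {1..r}}"

definition tvars :: "nat \<Rightarrow> nat \<Rightarrow> nat \<Rightarrow> tvar set" where
  "tvars p q r = Inl ` svars p q r \<union> Inr ` fvars p q r"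

definition complete_edges :: "'v set \<Rightarrow> 'v set set" where
  "complete_edges A = {{u, v} | u v. u \<in> A \<and> v \<in> A \<and> u \<noteq> v}"

definition Gamma_edges :: "nat \<Rightarrow> nat \<Rightarrow> nat \<Rightarrow> svar set set" where
  "Gamma_edges p q r = complete_edges (X ` {1..p} \<union> Y ` {1..q})
     \<union> complete_edges (X ` {1..p} \<union> Z ` {1..r})"

definition cover_ideal_Gamma :: "nat \<Rightarrow> nat \<Rightarrow> nat \<Rightarrow> (svar, 'k::field) mpoly set" where
  "cover_ideal_Gamma p q r = vertex_cover_ideal (svars p q r) (Gamma_edges p q r)"

definition g_gen :: "nat \<Rightarrow> nat \<Rightarrow> nat \<Rightarrow> nat \<Rightarrow> (svar, 'k::field) mpoly" where
  "g_gen p q r i = (\<Prod>i'\<in>{1..p} - {i}. var (X i')) * (\<Prod>j\<in>{1..q}. var (Y j)) * (\<Prod>k\<in>{1..r}. var (Z k))"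

definition f_gen :: "nat \<Rightarrow> nat \<Rightarrow> nat \<Rightarrow> nat \<Rightarrow> nat \<Rightarrow> (svar, 'k::field) mpoly" where
  "f_gen p q r j k = (\<Prod>i\<in>{1..p}. var (X i)) * (\<Prod>j'\<in>{1..q} - {j}. var (Y j')) * (\<Prod>k'\<in>{1..r} - {k}. var (Z k'))"

fun pi_var :: "nat \<Rightarrow> nat \<Rightarrow> nat \<Rightarrow> tvar \<Rightarrow> (svar, 'k::field) mpoly poly" where
  "pi_var p q r (Inl s) = Polynomial.monom (var s) 0"
| "pi_var p q r (Inr (Phi i)) = Polynomial.monom (g_gen p q r i) 1"
| "pi_var p q r (Inr (Psi j k)) = Polynomial.monom (f_gen p q r j k) 1"

definition pi_map :: "nat \<Rightarrow> nat \<Rightarrow> nat \<Rightarrow> (tvar, 'k::field) mpoly \<Rightarrow> (svar, 'k) mpoly poly" where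
  "pi_map p q r = subst (\<lambda>c. Polynomial.monom (const c) 0) (pi_var p q r)"

definition toric_ideal :: "nat \<Rightarrow> nat \<Rightarrow> nat \<Rightarrow> (tvar, 'k::field) mpoly set" where
  "toric_ideal p q r = a_kernel (pring (tvars p q r))
     (rees_algebra (svars p q r) (cover_ideal_Gamma p q r)) (pi_map p q r)"

abbreviation xT :: "nat \<Rightarrow> (tvar, 'k::field) mpoly" where "xT i \<equiv> var (Inl (X i))"
abbreviation yT :: "nat \<Rightarrow> (tvar, 'k::field) mpoly" where "yT j \<equiv> var (Inl (Y j))"
abbreviation zT :: "nat \<Rightarrow> (tvar, 'k::field) mpoly" where "zT k \<equiv> var (Inl (Z k))"
abbreviation \<phi> :: "nat \<Rightarrow> (tvar, 'k::field) mpoly" where "\<phi> i \<equiv> var (Inr (Phi i))"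
abbreviation \<psi> :: "nat \<Rightarrow> nat \<Rightarrow> (tvar, 'k::field) mpoly" where "\<psi> j k \<equiv> var (Inr (Psi j k))"


section \<open>The monomial order on \<open>T\<close>\<close>

text \<open>\<open>y\<^sub>q > \<dots> > y\<^sub>1 > z\<^sub>1 > \<dots> > z\<^sub>r > x\<^sub>p > \<dots> > x\<^sub>1\<close>\<close>

fun svar_less :: "svar \<Rightarrow> svar \<Rightarrow> bool" where
  "svar_less (X i) (X i') \<longleftrightarrow> i < i'"
| "svar_less (X i) (Y j') \<longleftrightarrow> True"
| "svar_less (X i) (Z k') \<longleftrightarrow> True"
| "svar_less (Y j) (X i') \<longleftrightarrow> False"
| "svar_less (Y j) (Y j') \<longleftrightarrow> j < j'"
| "svar_less (Y j) (Z k') \<longleftrightarrow> False"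
| "svar_less (Z k) (X i') \<longleftrightarrow> False"
| "svar_less (Z k) (Y j') \<longleftrightarrow> True"
| "svar_less (Z k) (Z k') \<longleftrightarrow> k > k'"

text \<open>\<open>\<phi>\<^sub>1 > \<dots> > \<phi>\<^sub>p\<close>, then all \<open>\<psi>\<close>, larger for smaller lower index and, for equal lower
  indices, for larger upper index.\<close>

fun fvar_less :: "fvar \<Rightarrow> fvar \<Rightarrow> bool" where
  "fvar_less (Phi i) (Phi i') \<longleftrightarrow> i > i'"
| "fvar_less (Phi i) (Psi j' k') \<longleftrightarrow> False"
| "fvar_less (Psi j k) (Phi i') \<longleftrightarrow> True"
| "fvar_less (Psi j k) (Psi j' k') \<longleftrightarrow> j > j' \<or> (j = j' \<and> k < k')"

text \<open>\<open>map_key Inl\<close> and \<open>map_key Inr\<close> extract the factors \<open>u\<close> and \<open>w\<close> of a monomial \<open>u w\<close> of \<open>T\<close>.\<close>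

definition tless :: "tvar mon \<Rightarrow> tvar mon \<Rightarrow> bool" where
  "tless m m' \<longleftrightarrow>
     lex_less fvar_less (Poly_Mapping.map_key Inr m) (Poly_Mapping.map_key Inr m') \<or>
     (Poly_Mapping.map_key Inr m = Poly_Mapping.map_key Inr m' \<and>
      lex_less svar_less (Poly_Mapping.map_key Inl m) (Poly_Mapping.map_key Inl m'))"



section \<open>Adequacy\<close>

text \<open>The structures above are commutative rings, the generators of the cover ideal are the
  \<open>g\<^sub>i\<close> and \<open>f\<^sub>j\<^sup>k\<close>, \<open>pi_map\<close> is a surjective ring homomorphism onto the Rees algebra, and \<open>tless\<close> is
  a monomial order.\<close>

lemma ring_on_simps [simp]:
  "carrier (ring_on A) = A" "\<one>\<^bsub>ring_on A\<^esub> = 1" "\<zero>\<^bsub>ring_on A\<^esub> = 0"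
  "a \<otimes>\<^bsub>ring_on A\<^esub> b = a * b" "a \<oplus>\<^bsub>ring_on A\<^esub> b = a + b"
  by (simp_all add: ring_on_def)

lemma cring_ring_on:
  assumes "0 \<in> A" "1 \<in> A" "\<And>a b. a \<in> A \<Longrightarrow> b \<in> A \<Longrightarrow> a + b \<in> A"
    "\<And>a b. a \<in> A \<Longrightarrow> b \<in> A \<Longrightarrow> a * b \<in> A" "\<And>a. a \<in> A \<Longrightarrow> - a \<in> A"
  shows "cring (ring_on A)"
proof (rule cringI)
  show "abelian_group (ring_on A)"
    by (rule abelian_groupI) (use assms in \<open>auto simp: add.assoc add.commute intro!: bexI[of _ "- _"]\<close>)
  show "comm_monoid (ring_on A)"
    by (rule comm_monoidI) (use assms in \<open>auto simp: mult.assoc mult.commute\<close>)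
qed (auto simp: distrib_right)

lemma in_pring_iff:
  "f \<in> carrier (pring V) \<longleftrightarrow> (\<forall>m\<in>Poly_Mapping.keys f. Poly_Mapping.keys m \<subseteq> V)"
  by (simp add: pring_def)

lemma pring_closed:
  "0 \<in> carrier (pring V)" "1 \<in> carrier (pring V)"
  "f \<in> carrier (pring V) \<Longrightarrow> - f \<in> carrier (pring V)"
  "f \<in> carrier (pring V) \<Longrightarrow> g \<in> carrier (pring V) \<Longrightarrow> f + g \<in> carrier (pring V)"
  "f \<in> carrier (pring V) \<Longrightarrow> g \<in> carrier (pring V) \<Longrightarrow> f * g \<in> carrier (pring V)"
proof -
  show "0 \<in> carrier (pring V)" "1 \<in> carrier (pring V)"
    by (simp_all add: in_pring_iff)
  show "- f \<in> carrier (pring V)" if "f \<in> carrier (pring V)"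
    using that by (auto simp: in_pring_iff in_keys_iff)
  show "f + g \<in> carrier (pring V)" if "f \<in> carrier (pring V)" "g \<in> carrier (pring V)"
    using that keys_add[of f g] by (fastforce simp: in_pring_iff)
  show "f * g \<in> carrier (pring V)" if f: "f \<in> carrier (pring V)" and g: "g \<in> carrier (pring V)"
    unfolding in_pring_iff
  proof
    fix m assume "m \<in> Poly_Mapping.keys (f * g)"
    then obtain a b where ab: "m = a + b" "a \<in> Poly_Mapping.keys f" "b \<in> Poly_Mapping.keys g"
      using keys_mult[of f g] by blast
    then show "Poly_Mapping.keys m \<subseteq> V"
      using f g keys_add[of a b] unfolding in_pring_iff by blast
  qed
qed

lemma cring_pring: "cring (pring V)"
proof -
  have "pring V = ring_on (carrier (pring V))" by (simp add: pring_def)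
  also have "cring \<dots>" by (intro cring_ring_on pring_closed)
  finally show ?thesis .
qed

lemma pring_simps [simp]:
  "\<one>\<^bsub>pring V\<^esub> = 1" "\<zero>\<^bsub>pring V\<^esub> = 0"
  "a \<otimes>\<^bsub>pring V\<^esub> b = a * b" "a \<oplus>\<^bsub>pring V\<^esub> b = a + b"
  by (simp_all add: pring_def)

lemma a_inv_pring: "f \<in> carrier (pring V) \<Longrightarrow> \<ominus>\<^bsub>pring V\<^esub> f = - f"
proof -
  interpret cring "pring V" by (rule cring_pring)
  show "f \<in> carrier (pring V) \<Longrightarrow> \<ominus>\<^bsub>pring V\<^esub> f = - f"
    using minus_equality[of "- f" f] pring_closed(3)[of f V] by simp
qed

lemma sum_closed:
  assumes "0 \<in> A" "\<And>a b. a \<in> A \<Longrightarrow> b \<in> A \<Longrightarrow> a + b \<in> (A :: 'a::comm_monoid_add set)"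
    and "\<And>i. i \<in> I \<Longrightarrow> f i \<in> A"
  shows "sum f I \<in> A"
  using assms(3) by (induction I rule: infinite_finite_induct) (auto intro: assms(1,2))

lemma prod_closed:
  assumes "1 \<in> A" "\<And>a b. a \<in> A \<Longrightarrow> b \<in> A \<Longrightarrow> a * b \<in> (A :: 'a::comm_monoid_mult set)"
    and "\<And>i. i \<in> I \<Longrightarrow> f i \<in> A"
  shows "prod f I \<in> A"
  using assms(3) by (induction I rule: infinite_finite_induct) (auto intro: assms(1,2))

lemma power_closed:
  assumes "1 \<in> A" "\<And>a b. a \<in> A \<Longrightarrow> b \<in> A \<Longrightarrow> a * b \<in> (A :: 'a::comm_monoid_mult set)" "a \<in> A"
  shows "a ^ n \<in> A"
  by (induction n) (auto intro: assms)

lemma const_in_pring: "const c \<in> carrier (pring V)"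
  by (simp add: in_pring_iff const_def)

lemma var_in_pring: "v \<in> V \<Longrightarrow> var v \<in> carrier (pring V)"
  by (simp add: in_pring_iff var_def monomial_def)

lemma coeff_mult_in_pring:
  assumes "\<And>n. Polynomial.coeff F n \<in> carrier (pring V)" "\<And>n. Polynomial.coeff G n \<in> carrier (pring V)"
  shows "Polynomial.coeff (F * G) n \<in> carrier (pring V)"
  unfolding coeff_mult by (intro sum_closed pring_closed assms)

lemma cring_pring_t: "cring (pring_t V)"
  unfolding pring_t_def
  by (rule cring_ring_on) (auto intro!: pring_closed coeff_mult_in_pring)

lemma pring_t_simps [simp]:
  "\<one>\<^bsub>pring_t V\<^esub> = 1" "\<zero>\<^bsub>pring_t V\<^esub> = 0"
  "a \<otimes>\<^bsub>pring_t V\<^esub> b = a * b" "a \<oplus>\<^bsub>pring_t V\<^esub> b = a + b"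
  by (simp_all add: pring_t_def)

lemma a_inv_pring_t: "F \<in> carrier (pring_t V) \<Longrightarrow> \<ominus>\<^bsub>pring_t V\<^esub> F = - F"
proof -
  interpret cring "pring_t V" by (rule cring_pring_t)
  have "- F \<in> carrier (pring_t V)" if "F \<in> carrier (pring_t V)"
    using that by (auto simp: pring_t_def intro: pring_closed)
  then show "F \<in> carrier (pring_t V) \<Longrightarrow> \<ominus>\<^bsub>pring_t V\<^esub> F = - F"
    using minus_equality[of "- F" F] by simp
qed

lemma monom_in_pring_t: "f \<in> carrier (pring V) \<Longrightarrow> Polynomial.monom f n \<in> carrier (pring_t V)"
  by (auto simp: pring_t_def intro: pring_closed)

lemma mpoly_induct [case_names zero add]:
  fixes f :: "('v, 'k::field) mpoly"
  assumes "P 0" "\<And>m c f. P f \<Longrightarrow> P (Poly_Mapping.single m c + f)"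
  shows "P f"
proof (induction f rule: update_induct)
  case const show ?case by fact
next
  case (update f a b)
  have "Poly_Mapping.update a b f = Poly_Mapping.single a b + f"
    using update(1) by (intro poly_mapping_eqI)
      (auto simp: lookup_update lookup_add lookup_single when_def in_keys_iff)
  then show ?case using assms(2)[OF update(3)] by simp
qed

definition mon_val :: "('v \<Rightarrow> 'b) \<Rightarrow> 'v mon \<Rightarrow> 'b::comm_ring_1" where
  "mon_val h m = (\<Prod>v\<in>Poly_Mapping.keys m. h v ^ Poly_Mapping.lookup m v)"

lemma mon_val_superset:
  assumes "finite A" "Poly_Mapping.keys m \<subseteq> A"
  shows "mon_val h m = (\<Prod>v\<in>A. h v ^ Poly_Mapping.lookup m v)"
  unfolding mon_val_def using assms by (intro prod.mono_neutral_left) (auto simp: in_keys_iff)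

lemma mon_val_0 [simp]: "mon_val h 0 = 1"
  by (simp add: mon_val_def)

lemma mon_val_add: "mon_val h (m + n) = mon_val h m * mon_val h n"
proof -
  let ?A = "Poly_Mapping.keys m \<union> Poly_Mapping.keys n"
  have *: "finite ?A" "Poly_Mapping.keys m \<subseteq> ?A" "Poly_Mapping.keys n \<subseteq> ?A" "Poly_Mapping.keys (m + n) \<subseteq> ?A"
    using keys_add[of m n] by auto
  show ?thesis
    unfolding mon_val_superset[OF *(1,2)] mon_val_superset[OF *(1,3)] mon_val_superset[OF *(1,4)]
    by (simp add: lookup_add power_add prod.distrib)
qed

locale coeff_hom =
  fixes e :: "'k::field \<Rightarrow> 'b::comm_ring_1"
  assumes e_0: "e 0 = 0" and e_1: "e 1 = 1"
    and e_add: "e (a + b) = e a + e b" and e_mult: "e (a * b) = e a * e b"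
begin

lemma subst_superset:
  assumes "finite A" "Poly_Mapping.keys f \<subseteq> A"
  shows "subst e h f = (\<Sum>m\<in>A. e (Poly_Mapping.lookup f m) * mon_val h m)"
  unfolding subst_def mon_val_def[symmetric]
  using assms by (intro sum.mono_neutral_left) (auto simp: in_keys_iff e_0)

lemma subst_0: "subst e h 0 = 0"
  by (simp add: subst_def)

lemma subst_add: "subst e h (f + g) = subst e h f + subst e h g"
proof -
  let ?A = "Poly_Mapping.keys f \<union> Poly_Mapping.keys g"
  have *: "finite ?A" "Poly_Mapping.keys f \<subseteq> ?A" "Poly_Mapping.keys g \<subseteq> ?A" "Poly_Mapping.keys (f + g) \<subseteq> ?A"
    using keys_add[of f g] by auto
  show ?thesis
    unfolding subst_superset[OF *(1,2)] subst_superset[OF *(1,3)] subst_superset[OF *(1,4)]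
    by (simp add: lookup_add e_add algebra_simps sum.distrib)
qed

lemma subst_single: "subst e h (Poly_Mapping.single m c) = e c * mon_val h m"
  using subst_superset[of "{m}" "Poly_Mapping.single m c" h] by simp

lemma subst_mult: "subst e h (f * g) = subst e h f * subst e h g"
proof (induction f rule: mpoly_induct)
  case zero then show ?case by (simp add: subst_0)
next
  case (add m c f)
  have "subst e h (Poly_Mapping.single m c * g) = subst e h (Poly_Mapping.single m c) * subst e h g"
    by (induction g rule: mpoly_induct)
      (simp_all add: subst_0 distrib_left subst_add mult_single subst_single e_mult mon_val_add mult_ac)
  with add show ?case by (simp add: distrib_right subst_add)
qed

lemma subst_1: "subst e h 1 = 1"
  using subst_single[of h 0 1] by (simp add: e_1)

lemma subst_const: "subst e h (const c) = e c"
  by (simp add: const_def subst_single)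

lemma subst_var: "subst e h (var v) = h v"
  by (simp add: var_def monomial_def subst_single e_1 mon_val_def)

end

interpretation pi: coeff_hom "\<lambda>c. Polynomial.monom (const c :: ('v, 'k::field) mpoly) 0"
proof
  show "Polynomial.monom (const 1 :: ('v, 'k) mpoly) 0 = 1"
    by (simp add: const_def monom_0 one_pCons)
qed (simp_all add: const_def monom_0 single_add mult_single mult_ac)

lemma complete_edges_meet:
  "(\<forall>e\<in>complete_edges A. e \<inter> D \<noteq> {}) \<longleftrightarrow> (\<forall>u\<in>A. \<forall>v\<in>A. u \<noteq> v \<longrightarrow> u \<in> D \<or> v \<in> D)"
proof
  assume *: "\<forall>e\<in>complete_edges A. e \<inter> D \<noteq> {}"
  show "\<forall>u\<in>A. \<forall>v\<in>A. u \<noteq> v \<longrightarrow> u \<in> D \<or> v \<in> D"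
  proof (intro ballI impI)
    fix u v assume "u \<in> A" "v \<in> A" "u \<noteq> v"
    then have "{u, v} \<in> complete_edges A" unfolding complete_edges_def by blast
    with * have "{u, v} \<inter> D \<noteq> {}" by blast
    then show "u \<in> D \<or> v \<in> D" by blast
  qed
qed (auto simp: complete_edges_def)

lemma minimal_iff:
  assumes "\<And>D. R D \<Longrightarrow> P D" "\<And>C. P C \<Longrightarrow> \<exists>D\<subseteq>C. R D"
    and "\<And>C D. R C \<Longrightarrow> R D \<Longrightarrow> D \<subseteq> C \<Longrightarrow> D = C"
  shows "(P C \<and> (\<forall>D. D \<subset> C \<longrightarrow> \<not> P D)) \<longleftrightarrow> R C"
  using assms by (metis psubsetE psubsetI subset_trans)

lemma minimal_vertex_cover_Gamma_iff:
  assumes "1 \<le> p" "1 \<le> q" "1 \<le> r"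
  shows "minimal_vertex_cover (svars p q r) (Gamma_edges p q r) C \<longleftrightarrow>
    (\<exists>i\<in>{1..p}. C = svars p q r - {X i}) \<or> (\<exists>j\<in>{1..q}. \<exists>k\<in>{1..r}. C = svars p q r - {Y j, Z k})"
    (is "?L C \<longleftrightarrow> ?R C")
proof -
  let ?V = "svars p q r" and ?E = "Gamma_edges p q r"
  let ?A = "X ` {1..p} \<union> Y ` {1..q}" and ?B = "X ` {1..p} \<union> Z ` {1..r}"
  have V: "?V = ?A \<union> ?B" by (auto simp: svars_def)
  have cover: "vertex_cover ?V ?E D \<longleftrightarrow> D \<subseteq> ?V \<and>
      (\<forall>u\<in>?A. \<forall>v\<in>?A. u \<noteq> v \<longrightarrow> u \<in> D \<or> v \<in> D) \<and> (\<forall>u\<in>?B. \<forall>v\<in>?B. u \<noteq> v \<longrightarrow> u \<in> D \<or> v \<in> D)" for D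
    unfolding vertex_cover_def Gamma_edges_def ball_Un complete_edges_meet ..
  have R_cover: "vertex_cover ?V ?E D" if "?R D" for D
    using that unfolding cover by (auto simp: svars_def)
  have sub: "\<exists>D\<subseteq>C. ?R D" if c: "vertex_cover ?V ?E C" for C
  proof (cases "\<exists>i\<in>{1..p}. X i \<notin> C")
    case True
    then obtain i where i: "i \<in> {1..p}" "X i \<notin> C" by blast
    have "?V - {X i} \<subseteq> C"
    proof
      fix v assume "v \<in> ?V - {X i}"
      then have v: "v \<in> ?A \<or> v \<in> ?B" "X i \<noteq> v" unfolding V by blast+
      have "X i \<in> ?A" "X i \<in> ?B" using i by blast+
      with v show "v \<in> C" using c i(2) unfolding cover by metis
    qed
    with i show ?thesis by blast
  next
    case False
    have "\<exists>j\<in>{1..q}. Y ` {1..q} - {Y j} \<subseteq> C"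
    proof (cases "\<exists>j\<in>{1..q}. Y j \<notin> C")
      case True
      then obtain j where j: "j \<in> {1..q}" "Y j \<notin> C" by blast
      have "Y ` {1..q} - {Y j} \<subseteq> C"
      proof
        fix v assume "v \<in> Y ` {1..q} - {Y j}"
        then have "v \<in> ?A" "Y j \<noteq> v" by blast+
        moreover have "Y j \<in> ?A" using j by blast
        ultimately show "v \<in> C" using c j(2) unfolding cover by metis
      qed
      with j(1) show ?thesis by blast
    next
      case False then show ?thesis using assms by (intro bexI[of _ 1]) auto
    qed
    moreover have "\<exists>k\<in>{1..r}. Z ` {1..r} - {Z k} \<subseteq> C"
    proof (cases "\<exists>k\<in>{1..r}. Z k \<notin> C")
      case True
      then obtain k where k: "k \<in> {1..r}" "Z k \<notin> C" by blast
      have "Z ` {1..r} - {Z k} \<subseteq> C"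
      proof
        fix v assume "v \<in> Z ` {1..r} - {Z k}"
        then have "v \<in> ?B" "Z k \<noteq> v" by blast+
        moreover have "Z k \<in> ?B" using k by blast
        ultimately show "v \<in> C" using c k(2) unfolding cover by metis
      qed
      with k(1) show ?thesis by blast
    next
      case False then show ?thesis using assms by (intro bexI[of _ 1]) auto
    qed
    ultimately obtain j k where jk: "j \<in> {1..q}" "k \<in> {1..r}"
      "Y ` {1..q} - {Y j} \<subseteq> C" "Z ` {1..r} - {Z k} \<subseteq> C" by blast
    have "?V - {Y j, Z k} \<subseteq> C" using jk False by (auto simp: svars_def)
    with jk show ?thesis by blast
  qed
  have antichain: "D = C" if "?R C" "?R D" "D \<subseteq> C" for C D
  proof -
    have inV: "X i \<in> ?V" if "i \<in> {1..p}" for i using that by (auto simp: svars_def)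
    have inV': "Y j \<in> ?V" if "j \<in> {1..q}" for j using that by (auto simp: svars_def)
    have inV'': "Z k \<in> ?V" if "k \<in> {1..r}" for k using that by (auto simp: svars_def)
    show ?thesis using that(1,2)
    proof (elim disjE bexE)
      fix i i' assume "i \<in> {1..p}" "C = ?V - {X i}" "i' \<in> {1..p}" "D = ?V - {X i'}"
      with that(3) inV[of i] have "X i = X i'" by blast
      with \<open>C = _\<close> \<open>D = _\<close> show ?thesis by simp
    next
      fix i j k assume *: "i \<in> {1..p}" "C = ?V - {X i}" "D = ?V - {Y j, Z k}"
      have "X i \<in> D" using inV[OF *(1)] unfolding *(3) by simp
      with that(3) * show ?thesis by blast
    next
      fix i j k assume *: "j \<in> {1..q}" "C = ?V - {Y j, Z k}" "D = ?V - {X i}"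
      have "Y j \<in> D" using inV'[OF *(1)] unfolding *(3) by simp
      with that(3) * show ?thesis by blast
    next
      fix j k j' k' assume *: "j \<in> {1..q}" "k \<in> {1..r}" "C = ?V - {Y j, Z k}" "D = ?V - {Y j', Z k'}"
      have "Y j \<notin> D" "Z k \<notin> D" using that(3) *(3) by blast+
      then have "Y j = Y j'" "Z k = Z k'" using inV'[OF *(1)] inV''[OF *(2)] unfolding *(4) by auto
      with \<open>C = _\<close> \<open>D = _\<close> show ?thesis by simp
    qed
  qed
  show ?thesis
    unfolding minimal_vertex_cover_def by (rule minimal_iff[of ?R]) (fact R_cover sub antichain)+
qed

lemma prod_svars_diff:
  "(\<Prod>v\<in>X ` P \<union> Y ` Q \<union> Z ` R. h v) = (\<Prod>i\<in>P. h (X i)) * (\<Prod>j\<in>Q. h (Y j)) * (\<Prod>k\<in>R. h (Z k))"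
  if "finite P" "finite Q" "finite R"
  using that by (subst prod.union_disjoint; (subst prod.union_disjoint)?)
    (auto simp: prod.reindex inj_on_def)

theorem cover_monomials_Gamma:
  assumes "1 \<le> p" "1 \<le> q" "1 \<le> r"
  shows "cover_monomials (svars p q r) (Gamma_edges p q r) =
    {g_gen p q r i | i. 1 \<le> i \<and> i \<le> p} \<union>
    {f_gen p q r j k | j k. 1 \<le> j \<and> j \<le> q \<and> 1 \<le> k \<and> k \<le> r}"
proof -
  have g: "(\<Prod>v\<in>svars p q r - {X i}. var v) = g_gen p q r i" for i
  proof -
    have "svars p q r - {X i} = X ` ({1..p} - {i}) \<union> Y ` {1..q} \<union> Z ` {1..r}"
      by (auto simp: svars_def)
    then show ?thesis by (simp add: prod_svars_diff g_gen_def)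
  qed
  have f: "(\<Prod>v\<in>svars p q r - {Y j, Z k}. var v) = f_gen p q r j k" for j k
  proof -
    have "svars p q r - {Y j, Z k} = X ` {1..p} \<union> Y ` ({1..q} - {j}) \<union> Z ` ({1..r} - {k})"
      by (auto simp: svars_def)
    then show ?thesis by (simp add: prod_svars_diff f_gen_def)
  qed
  show ?thesis
    unfolding cover_monomials_def minimal_vertex_cover_Gamma_iff[OF assms]
    unfolding Bex_def atLeastAtMost_iff g[symmetric] f[symmetric] by blast
qed

lemma pi_map_simps:
  "pi_map p q r (xT i) = Polynomial.monom (var (X i)) 0"
  "pi_map p q r (yT j) = Polynomial.monom (var (Y j)) 0"
  "pi_map p q r (zT k) = Polynomial.monom (var (Z k)) 0"
  "pi_map p q r (\<phi> i) = Polynomial.monom (g_gen p q r i) 1"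
  "pi_map p q r (\<psi> j k) = Polynomial.monom (f_gen p q r j k) 1"
  "pi_map p q r (const c) = Polynomial.monom (const c) 0"
  by (simp_all add: pi_map_def pi.subst_var pi.subst_const)

lemma cover_monomials_in_pring: "cover_monomials V E \<subseteq> carrier (pring V)"
  unfolding cover_monomials_def minimal_vertex_cover_def vertex_cover_def
  by (auto intro!: prod_closed pring_closed var_in_pring)

lemma ideal_vertex_cover_ideal: "ideal (vertex_cover_ideal V E) (pring V)"
proof -
  interpret cring "pring V" by (rule cring_pring)
  show ?thesis unfolding vertex_cover_ideal_def
    by (rule genideal_ideal[OF cover_monomials_in_pring])
qed

lemma rees_algebra_simps [simp]:
  "\<one>\<^bsub>rees_algebra V I\<^esub> = 1" "\<zero>\<^bsub>rees_algebra V I\<^esub> = 0"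
  "a \<otimes>\<^bsub>rees_algebra V I\<^esub> b = a * b" "a \<oplus>\<^bsub>rees_algebra V I\<^esub> b = a + b"
  by (simp_all add: rees_algebra_def)

lemma rees_generators_closed:
  assumes "ideal I (pring V)"
  shows "{Polynomial.monom f 0 | f. f \<in> carrier (pring V)} \<union> {Polynomial.monom f 1 | f. f \<in> I}
    \<subseteq> carrier (pring_t V)"
proof -
  interpret ideal I "pring V" by fact
  show ?thesis using a_subset by (auto intro!: monom_in_pring_t)
qed

lemma subring_rees_algebra:
  assumes "ideal I (pring V)"
  shows "subring (carrier (rees_algebra V I)) (pring_t V)"
proof -
  interpret cring "pring_t V" by (rule cring_pring_t)
  show ?thesis unfolding rees_algebra_def
    using generate_ring_is_subring[OF rees_generators_closed[OF assms]] by simp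
qed

lemma cring_rees_algebra:
  assumes "ideal I (pring V)"
  shows "cring (rees_algebra V I)"
proof -
  interpret cring "pring_t V" by (rule cring_pring_t)
  show ?thesis
    using subcring_iff[OF subringE(1)[OF subring_rees_algebra[OF assms]]]
      subcringI'[OF subring_rees_algebra[OF assms]]
    by (simp add: rees_algebra_def)
qed

theorem pi_map_hom_surj:
  fixes p q r :: nat
  assumes pqr: "1 \<le> p" "1 \<le> q" "1 \<le> r"
  defines "R \<equiv> rees_algebra (svars p q r) (cover_ideal_Gamma p q r :: (svar, 'k::field) mpoly set)"
  shows "pi_map p q r \<in> ring_hom (pring (tvars p q r)) R"
    and "pi_map p q r ` carrier (pring (tvars p q r)) = carrier R"
proof -
  let ?S = "pring (svars p q r) :: (svar, 'k) mpoly ring"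
  let ?T = "pring (tvars p q r) :: (tvar, 'k) mpoly ring"
  let ?I = "cover_ideal_Gamma p q r :: (svar, 'k) mpoly set"
  let ?H = "{Polynomial.monom f 0 | f. f \<in> carrier ?S} \<union> {Polynomial.monom f 1 | f. f \<in> ?I}"
  let ?pi = "pi_map p q r :: (tvar, 'k) mpoly \<Rightarrow> _"
  let ?M = "cover_monomials (svars p q r) (Gamma_edges p q r) :: (svar, 'k) mpoly set"
  interpret S: cring ?S by (rule cring_pring)
  interpret St: cring "pring_t (svars p q r)" by (rule cring_pring_t)
  have I: "ideal ?I ?S"
    unfolding cover_ideal_Gamma_def by (rule ideal_vertex_cover_ideal)
  have gens: "?M \<subseteq> ?I"
    unfolding cover_ideal_Gamma_def vertex_cover_ideal_def
    by (rule S.genideal_self[OF cover_monomials_in_pring])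
  have carR: "carrier R = generate_ring (pring_t (svars p q r)) ?H"
    by (simp add: R_def rees_algebra_def)
  have HR: "?H \<subseteq> carrier R" unfolding carR by (auto intro: generate_ring.incl)
  have subR: "subring (carrier R) (pring_t (svars p q r))"
    unfolding R_def by (rule subring_rees_algebra[OF I])
  note R_closed = subringE[OF subR, simplified]
  have "\<And>v. v \<in> tvars p q r \<Longrightarrow> pi_var p q r v \<in> carrier R"
  proof -
    fix v assume v: "v \<in> tvars p q r"
    have "pi_var p q r v \<in> ?H"
    proof (cases v)
      case (Inl s)
      then show ?thesis using v by (auto simp: tvars_def intro!: var_in_pring)
    next
      case (Inr w)
      have "g_gen p q r i \<in> ?I" if "i \<in> {1..p}" for i
        using gens that unfolding cover_monomials_Gamma[OF pqr] by auto
      moreover have "f_gen p q r j k \<in> ?I" if "j \<in> {1..q}" "k \<in> {1..r}" for j k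
        using gens that unfolding cover_monomials_Gamma[OF pqr] by force
      ultimately show ?thesis using v Inr by (auto simp: tvars_def fvars_def)
    qed
    then show "pi_var p q r v \<in> carrier R" using HR by blast
  qed
  moreover have "Polynomial.monom (const c) 0 \<in> carrier R" for c
    using HR const_in_pring[of c] by auto
  ultimately have range: "?pi f \<in> carrier R" if "f \<in> carrier ?T" for f
    using that unfolding pi_map_def subst_def in_pring_iff
    by (intro sum_closed R_closed prod_closed power_closed) auto
  show hom: "?pi \<in> ring_hom ?T R"
    using range by (auto intro!: ring_hom_memI simp: R_def pi_map_def pi.subst_mult pi.subst_add pi.subst_1)
  show "?pi ` carrier ?T = carrier R"
  proof
    show "?pi ` carrier ?T \<subseteq> carrier R" using range by blast
    let ?A = "?pi ` carrier ?T"
    have A0: "0 \<in> ?A" using pring_closed(1) pi.subst_0 unfolding pi_map_def by (metis image_eqI)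
    have A1: "1 \<in> ?A" using pring_closed(2) pi.subst_1 unfolding pi_map_def by (metis image_eqI)
    have Aadd: "a + b \<in> ?A" if "a \<in> ?A" "b \<in> ?A" for a b
      using that unfolding pi_map_def
      by (auto simp: pi.subst_add[symmetric] intro!: imageI pring_closed)
    have Amult: "a * b \<in> ?A" if "a \<in> ?A" "b \<in> ?A" for a b
      using that unfolding pi_map_def
      by (auto simp: pi.subst_mult[symmetric] intro!: imageI pring_closed)
    have Avar: "pi_var p q r v \<in> ?A" if "v \<in> tvars p q r" for v
      using var_in_pring[OF that] pi.subst_var unfolding pi_map_def by (metis image_eqI)
    have Aconst: "Polynomial.monom (const c) 0 \<in> ?A" for c
      using const_in_pring[of c] pi.subst_const unfolding pi_map_def by (metis image_eqI)
    have Aneg: "- a \<in> ?A" if "a \<in> ?A" for a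
    proof -
      have "(- 1 :: (svar, 'k) mpoly) = const (- 1)"
        by (simp add: const_def single_uminus)
      then have "- 1 \<in> ?A" using Aconst[of "- 1"] by (simp add: monom_0 one_pCons)
      from Amult[OF this that] show ?thesis by simp
    qed
    have AS: "Polynomial.monom f 0 \<in> ?A" if f: "f \<in> carrier ?S" for f
    proof -
      have "f = (\<Sum>m\<in>Poly_Mapping.keys f. const (Poly_Mapping.lookup f m) * mon_val var m)"
      proof -
        interpret id: coeff_hom "const :: 'k \<Rightarrow> (svar, 'k) mpoly"
          by standard (simp_all add: const_def single_add mult_single)
        have mv: "mon_val var m = (Poly_Mapping.single m 1 :: (svar, 'k) mpoly)" for m
        proof (induction m rule: update_induct)
          case const show ?case by simp
        next
          case (update m a b)
          have u: "Poly_Mapping.update a b m = Poly_Mapping.single a b + m"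
            using update(1) by (intro poly_mapping_eqI)
              (auto simp: lookup_update lookup_add lookup_single when_def in_keys_iff)
          have "(var a :: (svar, 'k) mpoly) ^ n = Poly_Mapping.single (Poly_Mapping.single a n) 1" for n
            by (induction n) (simp_all add: var_def monomial_def mult_single single_add[symmetric])
          then have "mon_val var (Poly_Mapping.single a b) =
              (Poly_Mapping.single (Poly_Mapping.single a b) 1 :: (svar, 'k) mpoly)"
            using update(2) by (simp add: mon_val_def)
          with update(3) show ?case by (simp add: u mon_val_add mult_single)
        qed
        have "subst const var f = f"
          by (induction f rule: mpoly_induct)
            (simp_all add: id.subst_0 id.subst_add id.subst_single mv, simp add: const_def mult_single)
        then show ?thesis by (simp add: subst_def mon_val_def)
      qed
      then have "Polynomial.monom f 0 =
          (\<Sum>m\<in>Poly_Mapping.keys f. Polynomial.monom (const (Poly_Mapping.lookup f m)) 0 *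
             (\<Prod>v\<in>Poly_Mapping.keys m. Polynomial.monom (var v) 0 ^ Poly_Mapping.lookup m v))"
      proof -
        have s: "Polynomial.monom (sum h A) 0 = (\<Sum>a\<in>A. Polynomial.monom (h a) 0)"
          for h :: "svar mon \<Rightarrow> (svar, 'k) mpoly" and A
          by (induction A rule: infinite_finite_induct) (simp_all add: add_monom[symmetric])
        have mm: "Polynomial.monom (a * b) 0 = Polynomial.monom a 0 * Polynomial.monom b 0"
          for a b :: "(svar, 'k) mpoly" by (simp add: mult_monom)
        have pr: "Polynomial.monom (prod h A) 0 = (\<Prod>a\<in>A. Polynomial.monom (h a) 0)"
          for h :: "svar \<Rightarrow> (svar, 'k) mpoly" and A
          by (induction A rule: infinite_finite_induct) (simp_all add: mm)
        have po: "Polynomial.monom (h ^ n) 0 = Polynomial.monom h 0 ^ n"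
          for h :: "(svar, 'k) mpoly" and n by (simp add: monom_power)
        assume "f = (\<Sum>m\<in>Poly_Mapping.keys f. const (Poly_Mapping.lookup f m) * mon_val var m)"
        then have "Polynomial.monom f 0 = Polynomial.monom
          (\<Sum>m\<in>Poly_Mapping.keys f. const (Poly_Mapping.lookup f m) * mon_val var m) 0" by simp
        then show ?thesis unfolding s mm mon_val_def pr po .
      qed
      moreover have "Polynomial.monom (var v) 0 \<in> ?A" if "v \<in> svars p q r" for v
        using Avar[of "Inl v"] that by (simp add: tvars_def)
      ultimately show ?thesis
        using f unfolding in_pring_iff
        by (auto intro!: sum_closed A0 A1 Aadd Amult Aconst prod_closed power_closed)
    qed
    have AI: "Polynomial.monom f 1 \<in> ?A" if "f \<in> ?I" for f
    proof -
      let ?J = "{f \<in> carrier ?S. Polynomial.monom f 1 \<in> ?A}"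
      have "ideal ?J ?S"
      proof (rule idealI)
        show "subgroup ?J (add_monoid ?S)"
        proof (rule S.add.subgroupI)
          show "?J \<noteq> {}" using A0 pring_closed(1) by force
          fix a assume a: "a \<in> ?J"
          have "\<ominus>\<^bsub>?S\<^esub> a = - a"
            using a by (auto intro: a_inv_pring)
          then show "\<ominus>\<^bsub>?S\<^esub> a \<in> ?J"
            using a Aneg[of "Polynomial.monom a 1"] by (auto simp: minus_monom intro: pring_closed)
        qed (auto simp: add_monom[symmetric] intro: pring_closed Aadd)
        fix a b assume ab: "a \<in> ?J" "b \<in> carrier ?S"
        have "Polynomial.monom (b * a) 1 = Polynomial.monom b 0 * Polynomial.monom a 1"
          by (simp add: mult_monom)
        then have "b * a \<in> ?J" using ab AS[of b] Amult by (auto intro: pring_closed)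
        then show "b \<otimes>\<^bsub>?S\<^esub> a \<in> ?J" "a \<otimes>\<^bsub>?S\<^esub> b \<in> ?J" by (simp_all add: mult.commute)
      qed (rule S.ring_axioms)
      moreover have "?M \<subseteq> ?J"
      proof
        fix a assume a: "a \<in> ?M"
        have "Polynomial.monom (g_gen p q r i) 1 \<in> ?A" if "i \<in> {1..p}" for i
          using Avar[of "Inr (Phi i)"] that by (simp add: tvars_def fvars_def)
        moreover have "Polynomial.monom (f_gen p q r j k) 1 \<in> ?A" if "j \<in> {1..q}" "k \<in> {1..r}" for j k
          using Avar[of "Inr (Psi j k)"] that by (simp add: tvars_def fvars_def)
        ultimately have "Polynomial.monom a 1 \<in> ?A"
          using a unfolding cover_monomials_Gamma[OF pqr] by force
        then show "a \<in> ?J" using a cover_monomials_in_pring by blast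
      qed
      ultimately have "?I \<subseteq> ?J"
        unfolding cover_ideal_Gamma_def vertex_cover_ideal_def by (rule S.genideal_minimal)
      with that show ?thesis by blast
    qed
    show "carrier R \<subseteq> ?A"
    proof
      fix F assume "F \<in> carrier R"
      then have F: "F \<in> generate_ring (pring_t (svars p q r)) ?H" by (simp add: carR)
      then show "F \<in> ?A"
      proof (induction rule: generate_ring.induct)
        case one then show ?case using A1 by simp
      next
        case (incl F) then show ?case using AS AI by blast
      next
        case (a_inv F)
        have "F \<in> carrier (pring_t (svars p q r))"
          by (rule St.generate_ring_in_carrier[OF rees_generators_closed[OF I] a_inv(1)])
        then have "\<ominus>\<^bsub>pring_t (svars p q r)\<^esub> F = - F"
          by (rule a_inv_pring_t)
        then show ?case using Aneg[OF a_inv(2)] by simp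
      next
        case (eng_add F G) then show ?case using Aadd by simp
      next
        case (eng_mult F G) then show ?case using Amult by simp
      qed
    qed
  qed
qed

lemma lex_less_irrefl: "\<not> lex_less vlt m m"
  by (simp add: lex_less_def)

lemma lex_less_add: "lex_less vlt (m + l) (m' + l) \<longleftrightarrow> lex_less vlt m m'"
  by (simp add: lex_less_def lookup_add)

lemma lex_less_trans:
  assumes trans: "transp vlt" and total: "totalp vlt" and "lex_less vlt m m'" "lex_less vlt m' m''"
  shows "lex_less vlt m m''"
proof -
  obtain v where v: "Poly_Mapping.lookup m v < Poly_Mapping.lookup m' v"
    "\<And>u. vlt v u \<Longrightarrow> Poly_Mapping.lookup m u = Poly_Mapping.lookup m' u"
    using assms(3) unfolding lex_less_def by blast
  obtain w where w: "Poly_Mapping.lookup m' w < Poly_Mapping.lookup m'' w"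
    "\<And>u. vlt w u \<Longrightarrow> Poly_Mapping.lookup m' u = Poly_Mapping.lookup m'' u"
    using assms(4) unfolding lex_less_def by blast
  consider "v = w" | "vlt v w" | "vlt w v" using total by (auto simp: totalp_on_def)
  then show ?thesis
  proof cases
    case 1 then show ?thesis using v w unfolding lex_less_def by (metis order.strict_trans)
  next
    case 2 then show ?thesis using v w transpD[OF trans 2] unfolding lex_less_def by metis
  next
    case 3 then show ?thesis using v w transpD[OF trans 3] unfolding lex_less_def by metis
  qed
qed

lemma lex_less_total:
  assumes "transp vlt" "asymp vlt" "totalp vlt" "m \<noteq> m'"
  shows "lex_less vlt m m' \<or> lex_less vlt m' m"
proof -
  let ?D = "{v. Poly_Mapping.lookup m v \<noteq> Poly_Mapping.lookup m' v}"
  have "?D \<subseteq> Poly_Mapping.keys m \<union> Poly_Mapping.keys m'"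
    by (auto simp: in_keys_iff)
  then have fin: "finite ?D" by (rule finite_subset) simp
  have "?D \<noteq> {}" using assms(4) poly_mapping_eqI[of m m'] by blast
  obtain v where v: "v \<in> ?D" "\<And>u. u \<in> ?D \<Longrightarrow> u \<noteq> v \<Longrightarrow> \<not> vlt v u"
    using Finite_Set.bex_max_element[of ?D vlt] fin \<open>?D \<noteq> {}\<close> assms(1,2)
    by (metis (no_types, lifting) asymp_on_subset subset_UNIV transp_on_subset)
  have "\<not> vlt v v" using assms(2) by (metis asympD)
  then have "vlt v u \<Longrightarrow> Poly_Mapping.lookup m u = Poly_Mapping.lookup m' u" for u
    using v(2)[of u] by auto
  with v(1) show ?thesis unfolding lex_less_def by (metis (mono_tags) mem_Collect_eq nat_neq_iff)
qed

lemma svar_less_order: "transp svar_less" "asymp svar_less" "totalp svar_less"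
proof -
  show "transp svar_less"
  proof (rule transpI)
    fix a b c show "svar_less a b \<Longrightarrow> svar_less b c \<Longrightarrow> svar_less a c"
      by (cases a; cases b; cases c) auto
  qed
  show "asymp svar_less"
  proof (rule asympI)
    fix a b show "svar_less a b \<Longrightarrow> \<not> svar_less b a" by (cases a; cases b) auto
  qed
  show "totalp svar_less"
  proof (rule totalpI)
    fix a b :: svar show "a \<noteq> b \<Longrightarrow> svar_less a b \<or> svar_less b a" by (cases a; cases b) auto
  qed
qed

lemma fvar_less_order: "transp fvar_less" "asymp fvar_less" "totalp fvar_less"
proof -
  show "transp fvar_less"
  proof (rule transpI)
    fix a b c show "fvar_less a b \<Longrightarrow> fvar_less b c \<Longrightarrow> fvar_less a c"
      by (cases a; cases b; cases c) auto
  qed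
  show "asymp fvar_less"
  proof (rule asympI)
    fix a b show "fvar_less a b \<Longrightarrow> \<not> fvar_less b a" by (cases a; cases b) auto
  qed
  show "totalp fvar_less"
  proof (rule totalpI)
    fix a b :: fvar show "a \<noteq> b \<Longrightarrow> fvar_less a b \<or> fvar_less b a" by (cases a; cases b) auto
  qed
qed

lemma tless_irrefl: "\<not> tless m m"
  by (simp add: tless_def lex_less_irrefl)

lemma tless_trans: "tless m m' \<Longrightarrow> tless m' m'' \<Longrightarrow> tless m m''"
  unfolding tless_def using lex_less_trans svar_less_order fvar_less_order by metis

lemma tless_total:
  assumes "m \<noteq> m'"
  shows "tless m m' \<or> tless m' m"
proof -
  have "Poly_Mapping.map_key Inl m \<noteq> Poly_Mapping.map_key Inl m' \<or>
    Poly_Mapping.map_key Inr m \<noteq> Poly_Mapping.map_key Inr m'"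
  proof (rule ccontr)
    assume eq: "\<not> ?thesis"
    have "Poly_Mapping.lookup m v = Poly_Mapping.lookup m' v" for v
    proof (cases v)
      case (Inl s)
      have "Poly_Mapping.lookup (Poly_Mapping.map_key Inl m) s = Poly_Mapping.lookup (Poly_Mapping.map_key Inl m') s"
        using eq by simp
      then show ?thesis using Inl by (simp add: map_key.rep_eq)
    next
      case (Inr w)
      have "Poly_Mapping.lookup (Poly_Mapping.map_key Inr m) w = Poly_Mapping.lookup (Poly_Mapping.map_key Inr m') w"
        using eq by simp
      then show ?thesis using Inr by (simp add: map_key.rep_eq)
    qed
    with assms show False by (metis poly_mapping_eqI)
  qed
  then show ?thesis unfolding tless_def using lex_less_total svar_less_order fvar_less_order by metis
qed

lemma tless_add: "tless (m + l) (m' + l) \<longleftrightarrow> tless m m'"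
  by (simp add: tless_def map_key_plus lex_less_add)

lemma tless_zero: "m \<noteq> 0 \<Longrightarrow> tless 0 m"
  using tless_total[of m 0] by (auto simp: tless_def lex_less_def)

end

theory Submission
  imports Defs
begin

text \<open>
  The map \<open>\<pi>\<close> sends monomials to monomials, so its kernel is governed by the fibres of \<open>\<pi>\<close> on
  monomials of \<open>T\<close>.  Call a monomial standard if it is divisible by none of the quadratic monomials
  in the claim.  Everything follows from the fact that no two standard monomials lie in the same
  fibre.

  This fact is proved by reading the exponents back off the image.  The \<open>t\<close>-degree \<open>n\<close> counts the
  \<open>\<phi>\<close> and \<open>\<psi>\<close> in the monomial.  Every \<open>\<phi>\<close> and \<open>\<psi>\<close> has all variables of \<open>S\<close> in its image except one or
  two, so the exponent of \<open>x\<^sub>i\<close> in the image, minus \<open>n\<close>, is the exponent of \<open>x\<^sub>i\<close> minus that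
  of \<open>\<phi>\<^sub>i\<close>.  One of the two vanishes in a standard monomial, hence the difference determines both.
  In the same way \<open>y\<^sub>j\<close> is paired with the row sum \<open>\<Sum>\<^sub>k \<psi>\<^sub>j\<^sup>k\<close> of the matrix of
  \<open>\<psi>\<close>-exponents, and \<open>z\<^sub>k\<close> with the column sum \<open>\<Sum>\<^sub>j \<psi>\<^sub>j\<^sup>k\<close>; the two pairs without
  a vanishing part, \<open>j = q\<close> and \<open>k = 1\<close>, are recovered because the sum of all entries of the matrix
  is known (\<open>complementary_parts_unique\<close>).  Finally, since none of the products of two \<open>\<psi>\<close> in the
  claim divides a standard monomial, the support of the matrix is a weakly increasing staircase, and
  such a matrix is determined by its row and column sums (\<open>staircase_unique\<close>).

  Each binomial of the basis replaces a divisor of a monomial by a smaller monomial in the same fibre.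
  Fibres are finite, so the least element of a fibre is standard, and by uniqueness a standard
  monomial is the least element of its fibre (\<open>standard_monomial_least\<close>).  If \<open>f \<noteq> 0\<close> lies in the toric
  ideal, its leading term is cancelled under \<open>\<pi>\<close> by some other, smaller, term in the same fibre.  So
  the leading monomial of \<open>f\<close> is not standard, which is the Groebner basis property.
\<close>

section \<open>Leading monomials and binomial Groebner bases\<close>

abbreviation pp_var :: "'v \<Rightarrow> 'v mon" where
  "pp_var v \<equiv> Poly_Mapping.single v 1"

lemma monomial_mult: "monomial a * monomial b = monomial (a + b)"
  by (simp add: monomial_def mult_single)

lemma monomial_in_pring: "monomial m \<in> carrier (pring V :: ('v, 'k::field) mpoly ring) \<longleftrightarrow> Poly_Mapping.keys m \<subseteq> V"
  by (simp add: in_pring_iff monomial_def)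

lemma keys_add_nat: "Poly_Mapping.keys (m + l) = Poly_Mapping.keys m \<union> Poly_Mapping.keys (l :: 'v mon)"
  by (auto simp: in_keys_iff lookup_add)

lemma lookup_binomial:
  assumes "a \<noteq> b"
  shows "Poly_Mapping.lookup (monomial a - monomial b :: ('v, 'k::field) mpoly) m =
    (if m = a then 1 else if m = b then - 1 else 0)"
  using assms by (simp add: lookup_minus monomial_def lookup_single when_def)

lemma keys_binomial:
  assumes "a \<noteq> b"
  shows "Poly_Mapping.keys (monomial a - monomial b :: ('v, 'k::field) mpoly) = {a, b}"
  using assms by (auto simp: in_keys_iff lookup_binomial split: if_splits)

locale strict_mon_order =
  fixes lt :: "'v mon \<Rightarrow> 'v mon \<Rightarrow> bool"
  assumes irrefl: "\<not> lt m m"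
    and trans: "lt m m' \<Longrightarrow> lt m' m'' \<Longrightarrow> lt m m''"
    and total: "m \<noteq> m' \<Longrightarrow> lt m m' \<or> lt m' m"
    and add: "lt m m' \<Longrightarrow> lt (m + l) (m' + l)"
begin

lemma lead_mon_eqI:
  assumes "m \<in> Poly_Mapping.keys f" "\<And>m'. m' \<in> Poly_Mapping.keys f \<Longrightarrow> m' \<noteq> m \<Longrightarrow> lt m' m"
  shows "lead_mon lt f = m"
  unfolding lead_mon_def
proof (rule the_equality)
  fix n assume n: "n \<in> Poly_Mapping.keys f \<and> (\<forall>m'\<in>Poly_Mapping.keys f. m' \<noteq> n \<longrightarrow> lt m' n)"
  show "n = m"
  proof (rule ccontr)
    assume "n \<noteq> m"
    then have "lt n m" "lt m n" using n assms by auto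
    then show False using trans irrefl by blast
  qed
qed (use assms in blast)

lemma finite_has_least:
  assumes "finite A" "A \<noteq> {}"
  obtains m where "m \<in> A" "\<And>m'. m' \<in> A \<Longrightarrow> \<not> lt m' m"
proof -
  have "\<exists>m\<in>A. \<forall>m'\<in>A. \<not> lt m' m"
    using assms by (induction A rule: finite_ne_induct) (metis irrefl singletonD singletonI, metis insertE insertI1 insertI2 irrefl trans)
  then show thesis using that by blast
qed

lemma finite_has_greatest:
  assumes "finite A" "A \<noteq> {}"
  obtains m where "m \<in> A" "\<And>m'. m' \<in> A \<Longrightarrow> m' \<noteq> m \<Longrightarrow> lt m' m"
proof -
  have "\<exists>m\<in>A. \<forall>m'\<in>A. m' \<noteq> m \<longrightarrow> lt m' m"
    using assms
  proof (induction A rule: finite_ne_induct)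
    case (insert a A)
    then show ?case by (metis insert_iff total trans)
  qed simp
  then show thesis using that by blast
qed

lemma lead_mon_greatest:
  assumes "f \<noteq> 0"
  shows "lead_mon lt f \<in> Poly_Mapping.keys f"
    and "m \<in> Poly_Mapping.keys f \<Longrightarrow> m \<noteq> lead_mon lt f \<Longrightarrow> lt m (lead_mon lt f)"
proof -
  obtain l where l: "l \<in> Poly_Mapping.keys f" "\<And>m'. m' \<in> Poly_Mapping.keys f \<Longrightarrow> m' \<noteq> l \<Longrightarrow> lt m' l"
    using finite_has_greatest[of "Poly_Mapping.keys f"] assms by auto
  then have "lead_mon lt f = l" by (rule lead_mon_eqI)
  with l show "lead_mon lt f \<in> Poly_Mapping.keys f"
    "m \<in> Poly_Mapping.keys f \<Longrightarrow> m \<noteq> lead_mon lt f \<Longrightarrow> lt m (lead_mon lt f)" by auto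
qed

lemma lead_mon_binomial:
  assumes "lt b a"
  shows "lead_mon lt (monomial a - monomial b :: ('v, 'k::field) mpoly) = a"
proof -
  have "a \<noteq> b" using assms irrefl by blast
  then show ?thesis using assms by (intro lead_mon_eqI) (auto simp: keys_binomial)
qed

text \<open>Divisibility of every leading monomial of \<open>J\<close> by the leading term of a pair already gives
  equality of the two monomial ideals: the cofactor of a power product over \<open>V\<close> is again over \<open>V\<close>.\<close>

lemma groebner_basis_of_binomials:
  fixes J :: "('v, 'k::field) mpoly set"
  assumes J: "J \<subseteq> carrier (pring V)" and fin: "finite B"
    and less: "\<And>a b. (a, b) \<in> B \<Longrightarrow> lt b a"
    and binomial: "\<And>a b. (a, b) \<in> B \<Longrightarrow> monomial a - monomial b \<in> J"
    and divides: "\<And>f. f \<in> J \<Longrightarrow> f \<noteq> 0 \<Longrightarrow> \<exists>(a, b)\<in>B. \<exists>l. lead_mon lt f = a + l"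
  shows "groebner_basis V lt J ((\<lambda>(a, b). monomial a - monomial b) ` B)"
    and "initial_ideal V lt J = Idl\<^bsub>pring V\<^esub> ((\<lambda>(a, b). monomial a) ` B)"
proof -
  interpret R: cring "pring V :: ('v, 'k) mpoly ring" by (rule cring_pring)
  let ?G = "(\<lambda>(a, b). monomial a - monomial b :: ('v, 'k) mpoly) ` B"
  let ?M = "(\<lambda>(a, b). monomial a :: ('v, 'k) mpoly) ` B"
  have nz: "monomial a - monomial b \<noteq> (0 :: ('v, 'k) mpoly)" if "(a, b) \<in> B" for a b
  proof -
    have "a \<noteq> b" using less[OF that] irrefl by blast
    then show ?thesis using keys_binomial[of a b, where 'k = 'k] by auto
  qed
  have lead: "{monomial (lead_mon lt g) | g. g \<in> ?G} = ?M"
  proof (intro equalityI subsetI)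
    fix g :: "('v, 'k) mpoly" assume "g \<in> {monomial (lead_mon lt g) | g. g \<in> ?G}"
    then obtain a b where "(a, b) \<in> B" "g = monomial (lead_mon lt (monomial a - monomial b :: ('v, 'k) mpoly))"
      by auto
    then show "g \<in> ?M" by (auto simp: lead_mon_binomial[OF less] intro!: rev_image_eqI)
  next
    fix g assume "g \<in> ?M"
    then obtain a b where ab: "(a, b) \<in> B" "g = monomial a" by auto
    then have "monomial a - monomial b \<in> ?G" by force
    moreover have "g = monomial (lead_mon lt (monomial a - monomial b :: ('v, 'k) mpoly))"
      by (simp add: lead_mon_binomial[OF less] ab)
    ultimately show "g \<in> {monomial (lead_mon lt g) | g. g \<in> ?G}" by blast
  qed
  have lead_in: "monomial (lead_mon lt f) \<in> carrier (pring V :: ('v, 'k) mpoly ring)" if "f \<in> J" "f \<noteq> 0" for f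
  proof -
    have "f \<in> carrier (pring V)" using J that(1) by (rule subsetD)
    then have "\<forall>m\<in>Poly_Mapping.keys f. Poly_Mapping.keys m \<subseteq> V"
      by (simp only: in_pring_iff)
    then show ?thesis
      using lead_mon_greatest(1)[OF that(2)] unfolding monomial_in_pring by blast
  qed
  let ?L = "{monomial (lead_mon lt f) | f. f \<in> J \<and> f \<noteq> 0} :: ('v, 'k) mpoly set"
  have L: "?L \<subseteq> carrier (pring V)" using lead_in by blast
  have M_sub: "?M \<subseteq> ?L"
  proof -
    have "?G \<subseteq> J - {0}" using binomial nz by auto
    then show ?thesis unfolding lead[symmetric] by blast
  qed
  have M: "?M \<subseteq> carrier (pring V)" using M_sub L by blast
  have "?L \<subseteq> Idl\<^bsub>pring V\<^esub> ?M"
  proof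
    fix g assume "g \<in> ?L"
    then obtain f where f: "g = monomial (lead_mon lt f)" "f \<in> J" "f \<noteq> 0" by blast
    then obtain a b l where abl: "(a, b) \<in> B" "lead_mon lt f = a + l" using divides by blast
    have "Poly_Mapping.keys l \<subseteq> V"
      using lead_in[OF f(2,3)] unfolding monomial_in_pring abl(2) keys_add_nat by blast
    then have "monomial l \<in> carrier (pring V :: ('v, 'k) mpoly ring)" by (simp add: monomial_in_pring)
    moreover have "monomial a \<in> Idl\<^bsub>pring V\<^esub> ?M"
      using R.genideal_self[OF M] abl(1) by force
    ultimately have "monomial a \<otimes>\<^bsub>pring V\<^esub> monomial l \<in> Idl\<^bsub>pring V\<^esub> ?M"
      by (intro ideal.I_r_closed[OF R.genideal_ideal[OF M]])
    then show "g \<in> Idl\<^bsub>pring V\<^esub> ?M" using f(1) abl(2) by (simp add: monomial_mult)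
  qed
  then have "Idl\<^bsub>pring V\<^esub> ?L \<subseteq> Idl\<^bsub>pring V\<^esub> ?M"
    by (rule R.genideal_minimal[OF R.genideal_ideal[OF M]])
  moreover have "Idl\<^bsub>pring V\<^esub> ?M \<subseteq> Idl\<^bsub>pring V\<^esub> ?L"
    using M_sub R.genideal_self[OF L] by (intro R.genideal_minimal[OF R.genideal_ideal[OF L]]) blast
  ultimately show init: "initial_ideal V lt J = Idl\<^bsub>pring V\<^esub> ?M"
    unfolding initial_ideal_def by (rule equalityI)
  have "finite ?G" using fin by (rule finite_imageI)
  moreover have "?G \<subseteq> J - {0}" using binomial nz by auto
  ultimately show "groebner_basis V lt J ?G"
    unfolding groebner_basis_def lead init by (intro conjI refl)
qed

end

interpretation tless: strict_mon_order tless
  by standard (rule tless_irrefl, erule (1) tless_trans, erule tless_total, simp only: tless_add)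


section \<open>Exponents of the images of monomials\<close>

text \<open>The monomial \<open>\<pi>(v)\<close> is squarefree in the variables of \<open>S\<close>; this is its support.  For the
  variables \<open>\<phi>\<close> and \<open>\<psi>\<close> it is given by its complement, which has one or two elements.\<close>

fun pi_support :: "nat \<Rightarrow> nat \<Rightarrow> nat \<Rightarrow> tvar \<Rightarrow> svar set" where
  "pi_support p q r (Inl s) = {s}"
| "pi_support p q r (Inr (Phi i)) = svars p q r - {X i}"
| "pi_support p q r (Inr (Psi j k)) = svars p q r - {Y j, Z k}"

definition t_deg :: "tvar \<Rightarrow> nat" where
  "t_deg v = (case v of Inl _ \<Rightarrow> 0 | Inr _ \<Rightarrow> 1)"

lemma t_deg_simps [simp]: "t_deg (Inl s) = 0" "t_deg (Inr w) = 1"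
  by (simp_all add: t_deg_def)

definition S_exp :: "nat \<Rightarrow> nat \<Rightarrow> nat \<Rightarrow> tvar mon \<Rightarrow> svar mon" where
  "S_exp p q r m = (\<Sum>v\<in>Poly_Mapping.keys m. \<Sum>u\<in>pi_support p q r v.
     Poly_Mapping.single u (Poly_Mapping.lookup m v))"

definition t_exp :: "tvar mon \<Rightarrow> nat" where
  "t_exp m = (\<Sum>v\<in>Poly_Mapping.keys m. Poly_Mapping.lookup m v * t_deg v)"

abbreviation pi_mon :: "nat \<Rightarrow> nat \<Rightarrow> nat \<Rightarrow> tvar mon \<Rightarrow> (svar, 'k::field) mpoly poly" where
  "pi_mon p q r \<equiv> mon_val (pi_var p q r)"

lemma finite_svars [simp]: "finite (svars p q r)"
  by (simp add: svars_def)

lemma finite_fvars [simp]: "finite (fvars p q r)"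
proof -
  have "fvars p q r = Phi ` {1..p} \<union> (\<lambda>(j, k). Psi j k) ` ({1..q} \<times> {1..r})"
    by (auto simp: fvars_def)
  then show ?thesis by simp
qed

lemma finite_tvars [simp]: "finite (tvars p q r)"
  by (simp add: tvars_def)

lemma finite_pi_support [simp]: "finite (pi_support p q r v)"
  by (cases "(p, q, r, v)" rule: pi_support.cases) auto

lemma prod_monomial: "(\<Prod>a\<in>A. monomial (h a)) = monomial (\<Sum>a\<in>A. h a)"
  by (induction A rule: infinite_finite_induct) (simp_all add: monomial_mult, simp_all add: monomial_def)

lemma monomial_power: "monomial m ^ n = monomial (\<Sum>i<n. m)"
  by (induction n) (simp_all add: monomial_mult add.commute, simp add: monomial_def)

lemma pi_var_monomial:
  "pi_var p q r v = Polynomial.monom (monomial (\<Sum>u\<in>pi_support p q r v. pp_var u)) (t_deg v)"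
proof (cases "(p, q, r, v)" rule: pi_support.cases)
  case (1 p q r s)
  then show ?thesis by (simp add: var_def)
next
  case (2 p' q' r' i)
  have "svars p q r - {X i} = X ` ({1..p} - {i}) \<union> Y ` {1..q} \<union> Z ` {1..r}"
    by (auto simp: svars_def)
  then have "g_gen p q r i = (\<Prod>u\<in>svars p q r - {X i}. var u)"
    by (simp add: prod_svars_diff g_gen_def)
  with 2 show ?thesis by (simp add: var_def prod_monomial)
next
  case (3 p' q' r' j k)
  have "svars p q r - {Y j, Z k} = X ` {1..p} \<union> Y ` ({1..q} - {j}) \<union> Z ` ({1..r} - {k})"
    by (auto simp: svars_def)
  then have "f_gen p q r j k = (\<Prod>u\<in>svars p q r - {Y j, Z k}. var u)"
    by (simp add: prod_svars_diff f_gen_def)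
  with 3 show ?thesis by (simp add: var_def prod_monomial)
qed

lemma prod_monom:
  "(\<Prod>a\<in>A. Polynomial.monom (monomial (h a) :: ('v, 'k::field) mpoly) (n a)) =
    Polynomial.monom (monomial (\<Sum>a\<in>A. h a)) (\<Sum>a\<in>A. n a)"
  by (induction A rule: infinite_finite_induct)
    (simp_all add: mult_monom monomial_mult, simp_all add: monomial_def one_pCons monom_0)

lemma single_sum_const: "(\<Sum>i<n. pp_var u) = Poly_Mapping.single u n"
  by (induction n) (simp_all add: single_add[symmetric])

lemma pi_mon_eq:
  "(pi_mon p q r m :: (svar, 'k::field) mpoly poly) = Polynomial.monom (monomial (S_exp p q r m)) (t_exp m)"
proof -
  have "(pi_var p q r v :: (svar, 'k) mpoly poly) ^ n = Polynomial.monom (monomial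
      (\<Sum>u\<in>pi_support p q r v. Poly_Mapping.single u n)) (n * t_deg v)" for v n
    unfolding pi_var_monomial monom_power monomial_power
    by (subst sum.swap) (simp add: single_sum_const[simplified] mult.commute)
  then show ?thesis by (simp add: mon_val_def prod_monom S_exp_def t_exp_def)
qed

lemma pi_mon_eq_iff:
  "(pi_mon p q r m :: (svar, 'k::field) mpoly poly) = pi_mon p q r m' \<longleftrightarrow>
    S_exp p q r m = S_exp p q r m' \<and> t_exp m = t_exp m'"
proof
  assume eq: "(pi_mon p q r m :: (svar, 'k) mpoly poly) = pi_mon p q r m'"
  have nz: "monomial n \<noteq> (0 :: (svar, 'k) mpoly)" for n
    unfolding monomial_def by (metis keys_single empty_not_insert keys_zero zero_neq_one)
  from eq have t: "t_exp m = t_exp m'"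
    unfolding pi_mon_eq by (metis degree_monom_eq nz)
  with eq have "monomial (S_exp p q r m) = (monomial (S_exp p q r m') :: (svar, 'k) mpoly)"
    unfolding pi_mon_eq by (metis coeff_monom)
  then have "Poly_Mapping.keys (monomial (S_exp p q r m) :: (svar, 'k) mpoly) =
      Poly_Mapping.keys (monomial (S_exp p q r m') :: (svar, 'k) mpoly)" by simp
  with t show "S_exp p q r m = S_exp p q r m' \<and> t_exp m = t_exp m'"
    by (simp add: monomial_def)
qed (simp add: pi_mon_eq)

text \<open>Distinct images of monomials are distinct monomials of \<open>S[t]\<close>, hence linearly independent;
  so every term of an element of the kernel is cancelled by another term with the same image.\<close>

lemma kernel_term_cancelled:
  fixes f :: "(tvar, 'k::field) mpoly"
  assumes "pi_map p q r f = 0" "m \<in> Poly_Mapping.keys f"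
  obtains m' where "m' \<in> Poly_Mapping.keys f" "m' \<noteq> m"
    "(pi_mon p q r m' :: (svar, 'k) mpoly poly) = pi_mon p q r m"
proof (rule ccontr)
  assume no: "\<not> thesis"
  let ?c = "\<lambda>n. Poly_Mapping.lookup f n"
  have term_eq: "Polynomial.monom (const (?c n)) 0 * pi_mon p q r n =
      Polynomial.monom (Poly_Mapping.single (S_exp p q r n) (?c n)) (t_exp n)" for n
    by (simp add: pi_mon_eq mult_monom const_def monomial_def mult_single)
  have "0 = (\<Sum>n\<in>Poly_Mapping.keys f. Polynomial.monom (Poly_Mapping.single (S_exp p q r n) (?c n)) (t_exp n))"
    using assms(1) unfolding pi_map_def subst_def mon_val_def[symmetric] term_eq by simp
  then have "0 = Poly_Mapping.lookup (Polynomial.coeff (\<Sum>n\<in>Poly_Mapping.keys f.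
      Polynomial.monom (Poly_Mapping.single (S_exp p q r n) (?c n)) (t_exp n)) (t_exp m)) (S_exp p q r m)"
    by (metis coeff_0 lookup_zero)
  also have "\<dots> = (\<Sum>n\<in>Poly_Mapping.keys f. if n = m then ?c n else 0)"
    unfolding coeff_sum lookup_sum
  proof (rule sum.cong[OF refl])
    fix n assume n: "n \<in> Poly_Mapping.keys f"
    have "S_exp p q r n = S_exp p q r m \<and> t_exp n = t_exp m \<longleftrightarrow> n = m"
      using no that[OF n] pi_mon_eq_iff[where 'k = 'k] by metis
    then show "Poly_Mapping.lookup (Polynomial.coeff (Polynomial.monom
        (Poly_Mapping.single (S_exp p q r n) (?c n)) (t_exp n)) (t_exp m)) (S_exp p q r m) =
        (if n = m then ?c n else 0)"
      by (auto simp: coeff_monom lookup_single when_def)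
  qed
  also have "\<dots> = ?c m" using assms(2) by simp
  finally show False using assms(2) by (simp add: in_keys_iff)
qed

lemma binomial_in_toric_ideal_iff:
  "(monomial a - monomial b :: (tvar, 'k::field) mpoly) \<in> toric_ideal p q r \<longleftrightarrow>
    monomial a - monomial b \<in> carrier (pring (tvars p q r) :: (tvar, 'k) mpoly ring) \<and>
    (pi_mon p q r a :: (svar, 'k) mpoly poly) = pi_mon p q r b"
proof -
  have m: "pi_map p q r (monomial n :: (tvar, 'k) mpoly) = pi_mon p q r n" for n
    by (simp add: pi_map_def monomial_def pi.subst_single) (simp add: const_def monom_0 one_pCons[symmetric])
  have "pi_map p q r (monomial a) = pi_map p q r (monomial a - monomial b) +
      pi_map p q r (monomial b :: (tvar, 'k) mpoly)"
    unfolding pi_map_def pi.subst_add[symmetric] by simp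
  then show ?thesis by (auto simp: toric_ideal_def a_kernel_def' m)
qed


section \<open>The fibres of the toric parametrization\<close>

lemma sum_fvars:
  "(\<Sum>w\<in>fvars p q r. h w) = (\<Sum>i\<in>{1..p}. h (Phi i)) + (\<Sum>j\<in>{1..q}. \<Sum>k\<in>{1..r}. h (Psi j k))"
proof -
  have "fvars p q r = Phi ` {1..p} \<union> (\<lambda>(j, k). Psi j k) ` ({1..q} \<times> {1..r})"
    by (auto simp: fvars_def)
  moreover have "Phi ` {1..p} \<inter> (\<lambda>(j, k). Psi j k) ` ({1..q} \<times> {1..r}) = {}" by auto
  ultimately have "(\<Sum>w\<in>fvars p q r. h w) = (\<Sum>w\<in>Phi ` {1..p}. h w) +
      (\<Sum>w\<in>(\<lambda>(j, k). Psi j k) ` ({1..q} \<times> {1..r}). h w)"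
    by (simp add: sum.union_disjoint)
  then show ?thesis
    by (simp add: sum.reindex inj_on_def sum.cartesian_product split_def)
qed

lemma sum_tvars:
  "(\<Sum>v\<in>tvars p q r. h v) = (\<Sum>s\<in>svars p q r. h (Inl s)) + (\<Sum>w\<in>fvars p q r. h (Inr w))"
  unfolding tvars_def by (subst sum.union_disjoint) (auto simp: sum.reindex inj_on_def)

context
  fixes p q r :: nat and m :: "tvar mon"
  assumes over: "Poly_Mapping.keys m \<subseteq> tvars p q r"
begin

lemma t_exp_sum: "t_exp m = (\<Sum>w\<in>fvars p q r. Poly_Mapping.lookup m (Inr w))"
proof -
  have "t_exp m = (\<Sum>v\<in>tvars p q r. Poly_Mapping.lookup m v * t_deg v)"
    unfolding t_exp_def using over by (intro sum.mono_neutral_left) (auto simp: in_keys_iff)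
  then show ?thesis by (simp add: sum_tvars)
qed

lemma lookup_S_exp:
  assumes "u \<in> svars p q r"
  shows "Poly_Mapping.lookup (S_exp p q r m) u = Poly_Mapping.lookup m (Inl u) +
    (\<Sum>w\<in>fvars p q r. if u \<in> pi_support p q r (Inr w) then Poly_Mapping.lookup m (Inr w) else 0)"
proof -
  have "Poly_Mapping.lookup (S_exp p q r m) u =
      (\<Sum>v\<in>Poly_Mapping.keys m. if u \<in> pi_support p q r v then Poly_Mapping.lookup m v else 0)"
    unfolding S_exp_def lookup_sum by (simp add: lookup_single when_def)
  also have "\<dots> = (\<Sum>v\<in>tvars p q r. if u \<in> pi_support p q r v then Poly_Mapping.lookup m v else 0)"
    using over by (intro sum.mono_neutral_left) (auto simp: in_keys_iff)
  finally show ?thesis using assms by (simp add: sum_tvars)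
qed

text \<open>Adding to the exponent of \<open>u\<close> the contribution of the \<open>\<phi>\<close> and \<open>\<psi>\<close> whose image misses \<open>u\<close>
  completes it to the contribution of all of them, which is the \<open>t\<close>-degree.
  This makes the exponents accessible because only \<open>\<phi>\<^sub>i\<close> misses \<open>x\<^sub>i\<close>, only one row of the \<open>\<psi>\<close>
  misses \<open>y\<^sub>j\<close> and only one column misses \<open>z\<^sub>k\<close>.\<close>

lemma S_exp_complement:
  assumes "u \<in> svars p q r"
  shows "Poly_Mapping.lookup (S_exp p q r m) u +
    (\<Sum>w\<in>fvars p q r. if u \<in> pi_support p q r (Inr w) then 0 else Poly_Mapping.lookup m (Inr w)) =
    Poly_Mapping.lookup m (Inl u) + t_exp m"
  unfolding lookup_S_exp[OF assms] t_exp_sum add.assoc sum.distrib[symmetric]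
  by (intro arg_cong2[where f = "(+)"] sum.cong refl) simp

lemma if_neq_swap: "(if a \<noteq> b then c else d) = (if a = b then d else c)"
  by simp

lemma S_exp_X:
  assumes "i \<in> {1..p}"
  shows "Poly_Mapping.lookup (S_exp p q r m) (X i) + Poly_Mapping.lookup m (Inr (Phi i)) =
    Poly_Mapping.lookup m (Inl (X i)) + t_exp m"
proof -
  have u: "X i \<in> svars p q r" using assms by (simp add: svars_def)
  have "(\<Sum>w\<in>fvars p q r. if X i \<in> pi_support p q r (Inr w) then 0 else Poly_Mapping.lookup m (Inr w)) =
      Poly_Mapping.lookup m (Inr (Phi i))"
    using u assms by (simp add: sum_fvars if_neq_swap)
  with S_exp_complement[OF u] show ?thesis by simp
qed

lemma S_exp_Y:
  assumes "j \<in> {1..q}"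
  shows "Poly_Mapping.lookup (S_exp p q r m) (Y j) + (\<Sum>k\<in>{1..r}. Poly_Mapping.lookup m (Inr (Psi j k))) =
    Poly_Mapping.lookup m (Inl (Y j)) + t_exp m"
proof -
  have u: "Y j \<in> svars p q r" using assms by (simp add: svars_def)
  have "(\<Sum>w\<in>fvars p q r. if Y j \<in> pi_support p q r (Inr w) then 0 else Poly_Mapping.lookup m (Inr w)) =
      (\<Sum>j'\<in>{1..q}. if j = j' then \<Sum>k\<in>{1..r}. Poly_Mapping.lookup m (Inr (Psi j' k)) else 0)"
    using u by (simp add: sum_fvars if_neq_swap del: sum.delta sum.delta')
      (auto simp del: sum.delta sum.delta' intro!: sum.cong)
  also have "\<dots> = (\<Sum>k\<in>{1..r}. Poly_Mapping.lookup m (Inr (Psi j k)))"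
    using assms by simp
  finally show ?thesis using S_exp_complement[OF u] by simp
qed

lemma S_exp_Z:
  assumes "k \<in> {1..r}"
  shows "Poly_Mapping.lookup (S_exp p q r m) (Z k) + (\<Sum>j\<in>{1..q}. Poly_Mapping.lookup m (Inr (Psi j k))) =
    Poly_Mapping.lookup m (Inl (Z k)) + t_exp m"
proof -
  have u: "Z k \<in> svars p q r" using assms by (simp add: svars_def)
  have "(\<Sum>w\<in>fvars p q r. if Z k \<in> pi_support p q r (Inr w) then 0 else Poly_Mapping.lookup m (Inr w)) =
      (\<Sum>j\<in>{1..q}. Poly_Mapping.lookup m (Inr (Psi j k)))"
    using u assms by (simp add: sum_fvars if_neq_swap)
  with S_exp_complement[OF u] show ?thesis by simp
qed

end

lemma finite_bounded_monomials:
  assumes "finite V"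
  shows "finite {n :: 'v mon. Poly_Mapping.keys n \<subseteq> V \<and> (\<forall>v\<in>V. Poly_Mapping.lookup n v \<le> N)}" (is "finite ?A")
proof (rule finite_imageD)
  have "Poly_Mapping.lookup ` ?A \<subseteq> {f. \<forall>v. (v \<in> V \<longrightarrow> f v \<in> {0..N}) \<and> (v \<notin> V \<longrightarrow> f v = 0)}"
    by (auto simp: in_keys_iff)
  then show "finite (Poly_Mapping.lookup ` ?A)"
    by (rule finite_subset) (rule finite_set_of_finite_funs[OF assms finite_atLeastAtMost])
  show "inj_on Poly_Mapping.lookup ?A"
    by (rule inj_onI) (rule poly_mapping_eqI, simp)
qed

text \<open>An exponent in a monomial of the fibre is bounded by the \<open>t\<close>-degree of the image if it belongs
  to some \<open>\<phi>\<close> or \<open>\<psi>\<close>, and otherwise by the exponent of the same variable in the image.\<close>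

lemma finite_fibre:
  "finite {n. Poly_Mapping.keys n \<subseteq> tvars p q r \<and> S_exp p q r n = s \<and> t_exp n = t}" (is "finite ?F")
proof (rule finite_subset)
  let ?N = "t + (\<Sum>u\<in>svars p q r. Poly_Mapping.lookup s u)"
  show "?F \<subseteq> {n. Poly_Mapping.keys n \<subseteq> tvars p q r \<and> (\<forall>v\<in>tvars p q r. Poly_Mapping.lookup n v \<le> ?N)}"
  proof (safe)
    fix n :: "tvar mon" and v
    assume n: "Poly_Mapping.keys n \<subseteq> tvars p q r" and v: "v \<in> tvars p q r"
    show "Poly_Mapping.lookup n v \<le> t_exp n + (\<Sum>u\<in>svars p q r. Poly_Mapping.lookup (S_exp p q r n) u)"
    proof (cases v)
      case (Inl u)
      then have u: "u \<in> svars p q r" using v by (auto simp: tvars_def)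
      have "Poly_Mapping.lookup n (Inl u) \<le> Poly_Mapping.lookup (S_exp p q r n) u"
        unfolding lookup_S_exp[OF n u] by simp
      also have "\<dots> \<le> (\<Sum>u\<in>svars p q r. Poly_Mapping.lookup (S_exp p q r n) u)"
        using u by (intro member_le_sum) auto
      finally show ?thesis using Inl by simp
    next
      case (Inr w)
      then have w: "w \<in> fvars p q r" using v by (auto simp: tvars_def)
      have "Poly_Mapping.lookup n (Inr w) \<le> t_exp n"
        unfolding t_exp_sum[OF n] using w by (intro member_le_sum) auto
      then show ?thesis using Inr by simp
    qed
  qed
qed (rule finite_bounded_monomials[OF finite_tvars])


section \<open>Staircase matrices\<close>

text \<open>A nonzero entry in the first \<open>J\<close> rows beyond column \<open>K\<close> and one in the first \<open>K\<close> columns beyond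
  row \<open>J\<close> would violate the assumption on \<open>e\<close>.  So one of these two regions is zero, and the upper
  left block carries the whole weight of its rows or the whole weight of its columns.\<close>

lemma staircase_block_sum:
  fixes e :: "nat \<Rightarrow> nat \<Rightarrow> nat"
  assumes stair: "\<And>j\<^sub>1 j\<^sub>2 k\<^sub>1 k\<^sub>2. 1 \<le> j\<^sub>1 \<Longrightarrow> j\<^sub>1 < j\<^sub>2 \<Longrightarrow> j\<^sub>2 \<le> q \<Longrightarrow> 1 \<le> k\<^sub>1 \<Longrightarrow> k\<^sub>1 < k\<^sub>2 \<Longrightarrow> k\<^sub>2 \<le> r \<Longrightarrow>
      e j\<^sub>1 k\<^sub>2 = 0 \<or> e j\<^sub>2 k\<^sub>1 = 0"
    and J: "J \<le> q" and K: "K \<le> r"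
  shows "(\<Sum>j\<in>{1..J}. \<Sum>k\<in>{1..K}. e j k) =
    min (\<Sum>j\<in>{1..J}. \<Sum>k\<in>{1..r}. e j k) (\<Sum>k\<in>{1..K}. \<Sum>j\<in>{1..q}. e j k)" (is "?S = min ?R ?C")
proof -
  have S: "?S = (\<Sum>k\<in>{1..K}. \<Sum>j\<in>{1..J}. e j k)" by (rule sum.swap)
  have le: "?S \<le> ?R" using K by (intro sum_mono sum_mono2) auto
  have le': "?S \<le> ?C" unfolding S using J by (intro sum_mono sum_mono2) auto
  show ?thesis
  proof (cases "\<forall>j\<in>{1..J}. \<forall>k\<in>{1..r} - {1..K}. e j k = 0")
    case True
    then have "?S = ?R" using K by (intro sum.cong refl sum.mono_neutral_left) auto
    with le le' show ?thesis by simp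
  next
    case False
    then obtain j\<^sub>1 k\<^sub>2 where jk: "j\<^sub>1 \<in> {1..J}" "k\<^sub>2 \<in> {1..r} - {1..K}" "e j\<^sub>1 k\<^sub>2 \<noteq> 0" by blast
    have "e j\<^sub>2 k\<^sub>1 = 0" if "k\<^sub>1 \<in> {1..K}" "j\<^sub>2 \<in> {1..q} - {1..J}" for j\<^sub>2 k\<^sub>1
      using stair[of j\<^sub>1 j\<^sub>2 k\<^sub>1 k\<^sub>2] jk that by auto
    then have "?S = ?C" using J unfolding S by (intro sum.cong refl sum.mono_neutral_left) auto
    with le le' show ?thesis by simp
  qed
qed

text \<open>Row and column sums determine all upper left block sums, and an entry is obtained from
  block sums by taking differences in both directions.\<close>

lemma staircase_unique:
  fixes e e' :: "nat \<Rightarrow> nat \<Rightarrow> nat"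
  assumes stair: "\<And>j\<^sub>1 j\<^sub>2 k\<^sub>1 k\<^sub>2. 1 \<le> j\<^sub>1 \<Longrightarrow> j\<^sub>1 < j\<^sub>2 \<Longrightarrow> j\<^sub>2 \<le> q \<Longrightarrow> 1 \<le> k\<^sub>1 \<Longrightarrow> k\<^sub>1 < k\<^sub>2 \<Longrightarrow> k\<^sub>2 \<le> r \<Longrightarrow>
      e j\<^sub>1 k\<^sub>2 = 0 \<or> e j\<^sub>2 k\<^sub>1 = 0"
    and stair': "\<And>j\<^sub>1 j\<^sub>2 k\<^sub>1 k\<^sub>2. 1 \<le> j\<^sub>1 \<Longrightarrow> j\<^sub>1 < j\<^sub>2 \<Longrightarrow> j\<^sub>2 \<le> q \<Longrightarrow> 1 \<le> k\<^sub>1 \<Longrightarrow> k\<^sub>1 < k\<^sub>2 \<Longrightarrow> k\<^sub>2 \<le> r \<Longrightarrow>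
      e' j\<^sub>1 k\<^sub>2 = 0 \<or> e' j\<^sub>2 k\<^sub>1 = 0"
    and row: "\<And>j. j \<in> {1..q} \<Longrightarrow> (\<Sum>k\<in>{1..r}. e j k) = (\<Sum>k\<in>{1..r}. e' j k)"
    and col: "\<And>k. k \<in> {1..r} \<Longrightarrow> (\<Sum>j\<in>{1..q}. e j k) = (\<Sum>j\<in>{1..q}. e' j k)"
    and jk: "j \<in> {1..q}" "k \<in> {1..r}"
  shows "e j k = e' j k"
proof -
  have block: "(\<Sum>j\<in>{1..J}. \<Sum>k\<in>{1..K}. e j k) = (\<Sum>j\<in>{1..J}. \<Sum>k\<in>{1..K}. e' j k)"
    if "J \<le> q" "K \<le> r" for J K
  proof -
    have "(\<Sum>j\<in>{1..J}. \<Sum>k\<in>{1..r}. e j k) = (\<Sum>j\<in>{1..J}. \<Sum>k\<in>{1..r}. e' j k)"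
      "(\<Sum>k\<in>{1..K}. \<Sum>j\<in>{1..q}. e j k) = (\<Sum>k\<in>{1..K}. \<Sum>j\<in>{1..q}. e' j k)"
      using that row col by (auto intro!: sum.cong)
    then show ?thesis
      using staircase_block_sum[of q r e J K, OF stair that] staircase_block_sum[of q r e' J K, OF stair' that]
      by simp
  qed
  obtain j\<^sub>0 k\<^sub>0 where j0: "j = Suc j\<^sub>0" and k0: "k = Suc k\<^sub>0"
    using jk by (metis atLeastAtMost_iff not_one_le_zero old.nat.exhaust)
  have row': "(\<Sum>k\<in>{1..K}. e j k) = (\<Sum>k\<in>{1..K}. e' j k)" if "K \<le> r" for K
    using block[of j K] block[of j\<^sub>0 K] that jk(1) by (simp add: j0)
  show ?thesis using row'[of k] row'[of k\<^sub>0] jk(2) by (simp add: k0)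
qed

text \<open>A pair of numbers one of which is zero is determined by its difference.  At the one index \<open>z\<close>
  where both may be nonzero, the total of the \<open>e\<close> supplies the missing information.\<close>

lemma complementary_parts_unique:
  fixes b e b' e' :: "'a \<Rightarrow> nat"
  assumes fin: "finite A" "z \<in> A" and sum: "sum e A = sum e' A"
    and diff: "\<And>i. i \<in> A \<Longrightarrow> e i + b' i = e' i + b i"
    and compl: "\<And>i. i \<in> A \<Longrightarrow> i \<noteq> z \<Longrightarrow> b i = 0 \<or> e i = 0"
      "\<And>i. i \<in> A \<Longrightarrow> i \<noteq> z \<Longrightarrow> b' i = 0 \<or> e' i = 0"
    and i: "i \<in> A"
  shows "e i = e' i \<and> b i = b' i"
proof -
  have off: "e i = e' i" if "i \<in> A" "i \<noteq> z" for i
    using diff[OF that(1)] compl[OF that] by auto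
  have "sum e (A - {z}) = sum e' (A - {z})" using off by (intro sum.cong) auto
  then have "e z = e' z" using sum by (simp add: sum.remove[OF fin])
  then show ?thesis using off diff[OF i] i by (cases "i = z") auto
qed


section \<open>The binomials and their standard monomials\<close>

text \<open>The binomials of the theorem, kept as pairs of a leading and a trailing monomial: in this form
  one monomial can be substituted for the other inside a larger one, and there is no coefficient
  field to carry along.\<close>

inductive_set relations :: "nat \<Rightarrow> nat \<Rightarrow> nat \<Rightarrow> (tvar mon \<times> tvar mon) set" for p q r where
  x_phi: "1 \<le> i \<Longrightarrow> i \<le> p \<Longrightarrow>
    (pp_var (Inl (X i)) + pp_var (Inr (Phi i)), pp_var (Inl (Y q)) + pp_var (Inl (Z 1)) + pp_var (Inr (Psi q 1))) \<in> relations p q r"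
| y_psi: "1 \<le> j \<Longrightarrow> j < q \<Longrightarrow> 1 \<le> k \<Longrightarrow> k \<le> r \<Longrightarrow>
    (pp_var (Inl (Y j)) + pp_var (Inr (Psi j k)), pp_var (Inl (Y q)) + pp_var (Inr (Psi q k))) \<in> relations p q r"
| z_psi: "1 \<le> j \<Longrightarrow> j \<le> q \<Longrightarrow> 1 < k \<Longrightarrow> k \<le> r \<Longrightarrow>
    (pp_var (Inl (Z k)) + pp_var (Inr (Psi j k)), pp_var (Inl (Z 1)) + pp_var (Inr (Psi j 1))) \<in> relations p q r"
| psi_psi: "1 \<le> j\<^sub>1 \<Longrightarrow> j\<^sub>1 < j\<^sub>2 \<Longrightarrow> j\<^sub>2 \<le> q \<Longrightarrow> 1 \<le> k\<^sub>1 \<Longrightarrow> k\<^sub>1 < k\<^sub>2 \<Longrightarrow> k\<^sub>2 \<le> r \<Longrightarrow>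
    (pp_var (Inr (Psi j\<^sub>1 k\<^sub>2)) + pp_var (Inr (Psi j\<^sub>2 k\<^sub>1)), pp_var (Inr (Psi j\<^sub>1 k\<^sub>1)) + pp_var (Inr (Psi j\<^sub>2 k\<^sub>2))) \<in> relations p q r"

lemma finite_relations: "finite (relations p q r)"
proof (rule finite_subset)
  show "relations p q r \<subseteq>
    (\<lambda>i. (pp_var (Inl (X i)) + pp_var (Inr (Phi i)), pp_var (Inl (Y q)) + pp_var (Inl (Z 1)) + pp_var (Inr (Psi q 1)))) ` {..p} \<union>
    (\<lambda>(j, k). (pp_var (Inl (Y j)) + pp_var (Inr (Psi j k)), pp_var (Inl (Y q)) + pp_var (Inr (Psi q k)))) ` ({..q} \<times> {..r}) \<union>
    (\<lambda>(j, k). (pp_var (Inl (Z k)) + pp_var (Inr (Psi j k)), pp_var (Inl (Z 1)) + pp_var (Inr (Psi j 1)))) ` ({..q} \<times> {..r}) \<union>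
    (\<lambda>(j\<^sub>1, j\<^sub>2, k\<^sub>1, k\<^sub>2). (pp_var (Inr (Psi j\<^sub>1 k\<^sub>2)) + pp_var (Inr (Psi j\<^sub>2 k\<^sub>1)), pp_var (Inr (Psi j\<^sub>1 k\<^sub>1)) + pp_var (Inr (Psi j\<^sub>2 k\<^sub>2)))) `
      ({..q} \<times> {..q} \<times> {..r} \<times> {..r})"
    (is "_ \<subseteq> ?A \<union> ?B \<union> ?C \<union> ?D")
  proof
    fix x assume "x \<in> relations p q r"
    moreover obtain a b where x: "x = (a, b)" by fastforce
    ultimately have "(a, b) \<in> relations p q r" by simp
    then show "x \<in> ?A \<union> ?B \<union> ?C \<union> ?D"
    proof cases
      case (x_phi i)
      then have "x \<in> ?A" unfolding x by (intro image_eqI[of _ _ i]) auto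
      then show ?thesis by blast
    next
      case (y_psi j k)
      then have "x \<in> ?B" unfolding x by (intro image_eqI[of _ _ "(j, k)"]) auto
      then show ?thesis by blast
    next
      case (z_psi j k)
      then have "x \<in> ?C" unfolding x by (intro image_eqI[of _ _ "(j, k)"]) auto
      then show ?thesis by blast
    next
      case (psi_psi j\<^sub>1 j\<^sub>2 k\<^sub>1 k\<^sub>2)
      then have "x \<in> ?D" unfolding x by (intro image_eqI[of _ _ "(j\<^sub>1, j\<^sub>2, k\<^sub>1, k\<^sub>2)"]) auto
      then show ?thesis by blast
    qed
  qed
qed auto

text \<open>Leading and trailing monomials differ in their \<open>\<phi>\<close>- and \<open>\<psi>\<close>-part, where the comparison is
  therefore decided.\<close>

lemma tlessI:
  assumes "Poly_Mapping.lookup m (Inr w) < Poly_Mapping.lookup m' (Inr w)"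
    and "\<And>w'. fvar_less w w' \<Longrightarrow> Poly_Mapping.lookup m (Inr w') = Poly_Mapping.lookup m' (Inr w')"
  shows "tless m m'"
  unfolding tless_def lex_less_def using assms by (auto simp: map_key.rep_eq)

lemma fvar_less_cases:
  "fvar_less (Phi i) w \<Longrightarrow> \<exists>i'. w = Phi i' \<and> i' < i"
  "fvar_less (Psi j k) w \<Longrightarrow> (\<exists>i'. w = Phi i') \<or> (\<exists>j' k'. w = Psi j' k' \<and> (j' < j \<or> j' = j \<and> k < k'))"
  by (cases w; auto)+

lemma relations_tless:
  assumes "(a, b) \<in> relations p q r"
  shows "tless b a"
  using assms
proof cases
  case (x_phi i)
  then show ?thesis
    by (intro tlessI[of _ "Phi i"]) (auto simp: lookup_add lookup_single when_def dest!: fvar_less_cases)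
next
  case (y_psi j k)
  then show ?thesis
    by (intro tlessI[of _ "Psi j k"]) (auto simp: lookup_add lookup_single when_def dest!: fvar_less_cases)
next
  case (z_psi j k)
  then show ?thesis
    by (intro tlessI[of _ "Psi j k"]) (auto simp: lookup_add lookup_single when_def dest!: fvar_less_cases)
next
  case (psi_psi j\<^sub>1 j\<^sub>2 k\<^sub>1 k\<^sub>2)
  then show ?thesis
    by (intro tlessI[of _ "Psi j\<^sub>1 k\<^sub>2"]) (auto simp: lookup_add lookup_single when_def dest!: fvar_less_cases)
qed

lemma relations_over_tvars:
  assumes "(a, b) \<in> relations p q r" "1 \<le> q" "1 \<le> r"
  shows "Poly_Mapping.keys a \<subseteq> tvars p q r" "Poly_Mapping.keys b \<subseteq> tvars p q r"
  using assms by (auto elim!: relations.cases simp: keys_add_nat tvars_def svars_def fvars_def)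

text \<open>The first relation holds because \<open>x\<^sub>i g\<^sub>i\<close> and \<open>y\<^sub>q z\<^sub>1 f\<^sub>q\<^sup>1\<close> are both the product of all variables;
  in the next two, multiplying \<open>f\<^sub>j\<^sup>k\<close> by \<open>y\<^sub>j\<close> or \<open>z\<^sub>k\<close> makes the dependence on \<open>j\<close> or \<open>k\<close> disappear.\<close>

lemma var_g_gen:
  assumes "i \<in> {1..p}"
  shows "var (X i) * g_gen p q r i = (\<Prod>i\<in>{1..p}. var (X i)) * (\<Prod>j\<in>{1..q}. var (Y j)) * (\<Prod>k\<in>{1..r}. var (Z k))"
  using assms by (simp add: g_gen_def prod.remove[of _ i] mult_ac)

lemma var_f_gen:
  shows "j \<in> {1..q} \<Longrightarrow> var (Y j) * f_gen p q r j k =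
      (\<Prod>i\<in>{1..p}. var (X i)) * (\<Prod>j\<in>{1..q}. var (Y j)) * (\<Prod>k\<in>{1..r} - {k}. var (Z k))"
    and "k \<in> {1..r} \<Longrightarrow> var (Z k) * f_gen p q r j k =
      (\<Prod>i\<in>{1..p}. var (X i)) * (\<Prod>j\<in>{1..q} - {j}. var (Y j)) * (\<Prod>k\<in>{1..r}. var (Z k))"
  by (simp_all add: f_gen_def prod.remove[of _ j] prod.remove[of _ k] mult_ac)

lemma relations_pi_mon:
  assumes "(a, b) \<in> relations p q r" and qr: "1 \<le> q" "1 \<le> r"
  shows "(pi_mon p q r a :: (svar, 'k::field) mpoly poly) = pi_mon p q r b"
proof -
  have pi_mon_var: "pi_mon p q r (pp_var v) = pi_var p q r v" for v
    by (simp add: mon_val_def)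
  from assms(1) show ?thesis
  proof cases
    case (x_phi i)
    have "var (Y q) * (var (Z 1) * f_gen p q r q 1) =
        (\<Prod>i\<in>{1..p}. var (X i)) * (\<Prod>j\<in>{1..q}. var (Y j)) * (\<Prod>k\<in>{1..r}. var (Z k) :: (svar, 'k) mpoly)"
    proof -
      have "(\<Prod>j\<in>{1..q}. var (Y j) :: (svar, 'k) mpoly) = var (Y q) * (\<Prod>j\<in>{1..q} - {q}. var (Y j))"
        using qr by (intro prod.remove) auto
      moreover have "1 \<in> {1..r}" using qr by simp
      ultimately show ?thesis by (simp only: var_f_gen(2) mult_ac)
    qed
    then show ?thesis
      using x_phi by (simp add: mon_val_add pi_mon_var[simplified] mult_monom mult.assoc var_g_gen)
  next
    case (y_psi j k)
    then show ?thesis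
      using qr by (simp add: mon_val_add pi_mon_var[simplified] mult_monom var_f_gen(1))
  next
    case (z_psi j k)
    then show ?thesis
      using qr by (simp add: mon_val_add pi_mon_var[simplified] mult_monom var_f_gen(2))
  next
    case psi_psi
    then show ?thesis
      by (simp add: mon_val_add pi_mon_var[simplified] mult_monom f_gen_def mult_ac)
  qed
qed

lemma two_variables_divide_iff:
  assumes "v \<noteq> w"
  shows "(\<exists>l. m = pp_var v + pp_var w + l) \<longleftrightarrow> Poly_Mapping.lookup m v \<noteq> 0 \<and> Poly_Mapping.lookup m w \<noteq> 0"
proof
  assume "Poly_Mapping.lookup m v \<noteq> 0 \<and> Poly_Mapping.lookup m w \<noteq> 0"
  then have "m = pp_var v + pp_var w + (m - (pp_var v + pp_var w))"
    using assms by (intro poly_mapping_eqI) (auto simp: lookup_add lookup_minus lookup_single when_def)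
  then show "\<exists>l. m = pp_var v + pp_var w + l" ..
qed (auto simp: lookup_add)

definition standard :: "nat \<Rightarrow> nat \<Rightarrow> nat \<Rightarrow> tvar mon \<Rightarrow> bool" where
  "standard p q r m \<longleftrightarrow> \<not> (\<exists>(a, b)\<in>relations p q r. \<exists>l. m = a + l)"

lemma standardD:
  assumes "standard p q r m"
  shows "i \<in> {1..p} \<Longrightarrow> Poly_Mapping.lookup m (Inl (X i)) = 0 \<or> Poly_Mapping.lookup m (Inr (Phi i)) = 0"
    and "j \<in> {1..q} \<Longrightarrow> j \<noteq> q \<Longrightarrow> k \<in> {1..r} \<Longrightarrow>
      Poly_Mapping.lookup m (Inl (Y j)) = 0 \<or> Poly_Mapping.lookup m (Inr (Psi j k)) = 0"
    and "j \<in> {1..q} \<Longrightarrow> k \<in> {1..r} \<Longrightarrow> k \<noteq> 1 \<Longrightarrow>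
      Poly_Mapping.lookup m (Inl (Z k)) = 0 \<or> Poly_Mapping.lookup m (Inr (Psi j k)) = 0"
    and "1 \<le> j\<^sub>1 \<Longrightarrow> j\<^sub>1 < j\<^sub>2 \<Longrightarrow> j\<^sub>2 \<le> q \<Longrightarrow> 1 \<le> k\<^sub>1 \<Longrightarrow> k\<^sub>1 < k\<^sub>2 \<Longrightarrow> k\<^sub>2 \<le> r \<Longrightarrow>
      Poly_Mapping.lookup m (Inr (Psi j\<^sub>1 k\<^sub>2)) = 0 \<or> Poly_Mapping.lookup m (Inr (Psi j\<^sub>2 k\<^sub>1)) = 0"
proof -
  have *: "Poly_Mapping.lookup m v = 0 \<or> Poly_Mapping.lookup m w = 0"
    if "(pp_var v + pp_var w, b) \<in> relations p q r" "v \<noteq> w" for v w b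
    using assms that two_variables_divide_iff[OF that(2), of m] unfolding standard_def by blast
  show "i \<in> {1..p} \<Longrightarrow> Poly_Mapping.lookup m (Inl (X i)) = 0 \<or> Poly_Mapping.lookup m (Inr (Phi i)) = 0"
    by (rule *[OF relations.x_phi]) auto
  show "j \<in> {1..q} \<Longrightarrow> j \<noteq> q \<Longrightarrow> k \<in> {1..r} \<Longrightarrow>
      Poly_Mapping.lookup m (Inl (Y j)) = 0 \<or> Poly_Mapping.lookup m (Inr (Psi j k)) = 0"
    by (rule *[OF relations.y_psi]) auto
  show "j \<in> {1..q} \<Longrightarrow> k \<in> {1..r} \<Longrightarrow> k \<noteq> 1 \<Longrightarrow>
      Poly_Mapping.lookup m (Inl (Z k)) = 0 \<or> Poly_Mapping.lookup m (Inr (Psi j k)) = 0"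
    by (rule *[OF relations.z_psi]) auto
  show "1 \<le> j\<^sub>1 \<Longrightarrow> j\<^sub>1 < j\<^sub>2 \<Longrightarrow> j\<^sub>2 \<le> q \<Longrightarrow> 1 \<le> k\<^sub>1 \<Longrightarrow> k\<^sub>1 < k\<^sub>2 \<Longrightarrow> k\<^sub>2 \<le> r \<Longrightarrow>
      Poly_Mapping.lookup m (Inr (Psi j\<^sub>1 k\<^sub>2)) = 0 \<or> Poly_Mapping.lookup m (Inr (Psi j\<^sub>2 k\<^sub>1)) = 0"
    by (rule *[OF relations.psi_psi]) auto
qed

text \<open>In the image, each of \<open>x\<^sub>i\<close>, \<open>y\<^sub>j\<close>, \<open>z\<^sub>k\<close> reveals the difference of its exponent in \<open>m\<close> and that of
  \<open>\<phi>\<^sub>i\<close>, row sum \<open>j\<close> or column sum \<open>k\<close> of the \<open>\<psi>\<close>-exponents.  The \<open>\<phi>\<close>-exponents come first: subtracting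
  them from the \<open>t\<close>-degree leaves the sum of all \<open>\<psi>\<close>-exponents, on which the row and column sums at
  the exceptional indices \<open>q\<close> and \<open>1\<close> depend.\<close>

lemma standard_monomial_unique:
  assumes qr: "1 \<le> q" "1 \<le> r"
    and over: "Poly_Mapping.keys m \<subseteq> tvars p q r" "Poly_Mapping.keys m' \<subseteq> tvars p q r"
    and std: "standard p q r m" "standard p q r m'"
    and S: "S_exp p q r m = S_exp p q r m'" and t: "t_exp m = t_exp m'"
  shows "m = m'"
proof -
  let ?l = "Poly_Mapping.lookup m" and ?l' = "Poly_Mapping.lookup m'"
  define row col where "row = (\<lambda>l :: tvar \<Rightarrow> nat. \<lambda>j. \<Sum>k\<in>{1..r}. l (Inr (Psi j k)))"
    and "col = (\<lambda>l :: tvar \<Rightarrow> nat. \<lambda>k. \<Sum>j\<in>{1..q}. l (Inr (Psi j k)))"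
  have x: "?l (Inl (X i)) = ?l' (Inl (X i))" "?l (Inr (Phi i)) = ?l' (Inr (Phi i))"
    if "i \<in> {1..p}" for i
    using standardD(1)[OF std(1) that] standardD(1)[OF std(2) that]
      S_exp_X[OF over(1) that] S_exp_X[OF over(2) that] S t by auto
  have "(\<Sum>i\<in>{1..p}. ?l (Inr (Phi i))) = (\<Sum>i\<in>{1..p}. ?l' (Inr (Phi i)))"
    using x by (intro sum.cong) auto
  then have total_row: "sum (row ?l) {1..q} = sum (row ?l') {1..q}"
    using t unfolding t_exp_sum[OF over(1)] t_exp_sum[OF over(2)] sum_fvars row_def by simp
  then have total_col: "sum (col ?l) {1..r} = sum (col ?l') {1..r}"
    unfolding row_def col_def by (subst (1 2) sum.swap)
  have y: "row ?l j = row ?l' j \<and> ?l (Inl (Y j)) = ?l' (Inl (Y j))" if "j \<in> {1..q}" for j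
  proof (rule complementary_parts_unique[where z = q, OF _ _ total_row _ _ _ that])
    fix i assume i: "i \<in> {1..q}"
    show "row ?l i + ?l' (Inl (Y i)) = row ?l' i + ?l (Inl (Y i))"
      using S_exp_Y[OF over(1) i] S_exp_Y[OF over(2) i] unfolding row_def S t by linarith
    assume "i \<noteq> q"
    then show "?l (Inl (Y i)) = 0 \<or> row ?l i = 0" "?l' (Inl (Y i)) = 0 \<or> row ?l' i = 0"
      using standardD(2)[OF std(1) i] standardD(2)[OF std(2) i] unfolding row_def by auto
  qed (use qr in auto)
  have z: "col ?l k = col ?l' k \<and> ?l (Inl (Z k)) = ?l' (Inl (Z k))" if "k \<in> {1..r}" for k
  proof (rule complementary_parts_unique[where z = 1, OF _ _ total_col _ _ _ that])
    fix i assume i: "i \<in> {1..r}"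
    show "col ?l i + ?l' (Inl (Z i)) = col ?l' i + ?l (Inl (Z i))"
      using S_exp_Z[OF over(1) i] S_exp_Z[OF over(2) i] unfolding col_def S t by linarith
    assume "i \<noteq> 1"
    then show "?l (Inl (Z i)) = 0 \<or> col ?l i = 0" "?l' (Inl (Z i)) = 0 \<or> col ?l' i = 0"
      using standardD(3)[OF std(1) _ i] standardD(3)[OF std(2) _ i] unfolding col_def by auto
  qed (use qr in auto)
  have psi: "?l (Inr (Psi j k)) = ?l' (Inr (Psi j k))" if "j \<in> {1..q}" "k \<in> {1..r}" for j k
    using standardD(4)[OF std(1)] standardD(4)[OF std(2)] y z that
    by (intro staircase_unique[where e = "\<lambda>j k. ?l (Inr (Psi j k))" and e' = "\<lambda>j k. ?l' (Inr (Psi j k))"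
        and q = q and r = r]) (auto simp: row_def col_def)
  show ?thesis
  proof (rule poly_mapping_eqI)
    fix v
    show "?l v = ?l' v"
    proof (cases "v \<in> tvars p q r")
      case True
      then show ?thesis using x y z psi by (auto simp: tvars_def svars_def fvars_def)
    next
      case False
      then show ?thesis using over by (metis in_keys_iff subsetD)
    qed
  qed
qed

text \<open>The least element of the fibre is standard, since otherwise a relation would produce a smaller
  element; by uniqueness it is \<open>m\<close>.\<close>

lemma standard_monomial_least:
  assumes qr: "1 \<le> q" "1 \<le> r"
    and over: "Poly_Mapping.keys m \<subseteq> tvars p q r" "Poly_Mapping.keys m' \<subseteq> tvars p q r"
    and std: "standard p q r m"
    and same: "S_exp p q r m' = S_exp p q r m" "t_exp m' = t_exp m"
  shows "\<not> tless m' m"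
proof -
  let ?F = "{n. Poly_Mapping.keys n \<subseteq> tvars p q r \<and> S_exp p q r n = S_exp p q r m \<and> t_exp n = t_exp m}"
  have ne: "?F \<noteq> {}" using over by blast
  obtain n where n: "n \<in> ?F" "\<And>n'. n' \<in> ?F \<Longrightarrow> \<not> tless n' n"
    by (rule tless.finite_has_least[OF finite_fibre ne], rule that)
  have "standard p q r n"
  proof (rule ccontr)
    assume "\<not> standard p q r n"
    then obtain a b l where ab: "(a, b) \<in> relations p q r" "n = a + l"
      unfolding standard_def by blast
    \<comment> \<open>The fibres do not depend on the coefficient field, so any field serves here.\<close>
    have "pi_mon p q r (b + l) = (pi_mon p q r n :: (svar, rat) mpoly poly)"
      using relations_pi_mon[OF ab(1) qr, where 'k = rat] by (simp add: ab(2) mon_val_add)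
    then have "b + l \<in> ?F"
      using n(1) relations_over_tvars[OF ab(1) qr] ab(2) by (auto simp: pi_mon_eq_iff keys_add_nat)
    moreover have "tless (b + l) n"
      using relations_tless[OF ab(1)] by (simp add: ab(2) tless_add)
    ultimately show False using n(2) by blast
  qed
  then have "n = m"
    using n(1) over(1) std by (intro standard_monomial_unique[OF qr]) auto
  then show ?thesis using n(2) over(2) same by auto
qed

lemma toric_lead_mon_not_standard:
  fixes f :: "(tvar, 'k::field) mpoly"
  assumes qr: "1 \<le> q" "1 \<le> r" and f: "f \<in> toric_ideal p q r" "f \<noteq> 0"
  shows "\<not> standard p q r (lead_mon tless f)"
proof
  assume std: "standard p q r (lead_mon tless f)"
  have over: "Poly_Mapping.keys m \<subseteq> tvars p q r" if "m \<in> Poly_Mapping.keys f" for m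
    using f(1) that by (auto simp: toric_ideal_def a_kernel_def' in_pring_iff)
  have "pi_map p q r f = 0" using f(1) by (simp add: toric_ideal_def a_kernel_def')
  then obtain m where m: "m \<in> Poly_Mapping.keys f" "m \<noteq> lead_mon tless f"
      "(pi_mon p q r m :: (svar, 'k) mpoly poly) = pi_mon p q r (lead_mon tless f)"
    using kernel_term_cancelled tless.lead_mon_greatest(1)[OF f(2)] by metis
  then show False
    using standard_monomial_least[OF qr over over std, of m] tless.lead_mon_greatest[OF f(2)]
    unfolding pi_mon_eq_iff by blast
qed

text \<open>Leading monomials are squarefree, so divisibility is inclusion of supports.  A trailing monomial
  contains from \<open>y\<close> and \<open>z\<close> only \<open>y\<^sub>q\<close> and \<open>z\<^sub>1\<close>, and its \<open>\<psi>\<close> form a staircase, so it contains no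
  leading support; and the support of a leading monomial determines its relation.\<close>

lemma relations_reduced:
  assumes "(a, b) \<in> relations p q r" "(a', b') \<in> relations p q r" "a + l = a' \<or> a + l = b'"
  shows "(a, b) = (a', b')"
proof -
  have "Poly_Mapping.keys a \<subseteq> Poly_Mapping.keys a' \<or> Poly_Mapping.keys a \<subseteq> Poly_Mapping.keys b'"
    using assms(3) keys_add_nat[of a l] by blast
  with assms(1,2) show ?thesis
    by (elim relations.cases) (auto simp: keys_add_nat)
qed

theorem theorem4p1:
  fixes p q r :: nat
  assumes "1 \<le> p" and "1 \<le> q" and "1 \<le> r"
  shows "reduced_groebner_basis (tvars p q r) tless
      (toric_ideal p q r :: (tvar, 'k::field) mpoly set)
      ({xT i * \<phi> i - yT q * zT 1 * \<psi> q 1 | i. 1 \<le> i \<and> i \<le> p}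
       \<union> {yT j * \<psi> j k - yT q * \<psi> q k | j k. 1 \<le> j \<and> j < q \<and> 1 \<le> k \<and> k \<le> r}
       \<union> {zT k * \<psi> j k - zT 1 * \<psi> j 1 | j k. 1 \<le> j \<and> j \<le> q \<and> 1 < k \<and> k \<le> r}
       \<union> {\<psi> j\<^sub>1 k\<^sub>2 * \<psi> j\<^sub>2 k\<^sub>1 - \<psi> j\<^sub>1 k\<^sub>1 * \<psi> j\<^sub>2 k\<^sub>2 | j\<^sub>1 j\<^sub>2 k\<^sub>1 k\<^sub>2.
            1 \<le> j\<^sub>1 \<and> j\<^sub>1 < j\<^sub>2 \<and> j\<^sub>2 \<le> q \<and> 1 \<le> k\<^sub>1 \<and> k\<^sub>1 < k\<^sub>2 \<and> k\<^sub>2 \<le> r})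
    \<and> initial_ideal (tvars p q r) tless (toric_ideal p q r :: (tvar, 'k) mpoly set) =
      Idl\<^bsub>pring (tvars p q r)\<^esub>
      ({xT i * \<phi> i | i. 1 \<le> i \<and> i \<le> p}
       \<union> {yT j * \<psi> j k | j k. 1 \<le> j \<and> j < q \<and> 1 \<le> k \<and> k \<le> r}
       \<union> {zT k * \<psi> j k | j k. 1 \<le> j \<and> j \<le> q \<and> 1 < k \<and> k \<le> r}
       \<union> {\<psi> j\<^sub>1 k\<^sub>2 * \<psi> j\<^sub>2 k\<^sub>1 | j\<^sub>1 j\<^sub>2 k\<^sub>1 k\<^sub>2.
            1 \<le> j\<^sub>1 \<and> j\<^sub>1 < j\<^sub>2 \<and> j\<^sub>2 \<le> q \<and> 1 \<le> k\<^sub>1 \<and> k\<^sub>1 < k\<^sub>2 \<and> k\<^sub>2 \<le> r})"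
    (is "reduced_groebner_basis _ _ ?J ?G \<and> _ = Idl\<^bsub>_\<^esub> ?M")
proof -
  let ?R = "relations p q r"
  let ?B = "(\<lambda>(a, b). monomial a - monomial b :: (tvar, 'k) mpoly) ` ?R"
  have in_B: "monomial a - monomial b \<in> ?B" if "(a, b) \<in> ?R" for a b
    using that by (auto intro!: rev_image_eqI)
  have G: "?G = ?B"
  proof (intro equalityI subsetI)
    fix g assume "g \<in> ?G"
    then show "g \<in> ?B"
      unfolding var_def monomial_mult
      by (elim UnE CollectE exE conjE) (hypsubst, rule in_B, rule relations.intros, assumption+)+
  next
    fix g assume "g \<in> ?B"
    then obtain a b where "(a, b) \<in> ?R" "g = monomial a - monomial b" by auto
    then show "g \<in> ?G"
      unfolding var_def monomial_mult by cases blast+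
  qed
  have in_M: "monomial a \<in> (\<lambda>(a, b). monomial a :: (tvar, 'k) mpoly) ` ?R" if "(a, b) \<in> ?R" for a b
    using that by (auto intro!: rev_image_eqI)
  have M: "?M = (\<lambda>(a, b). monomial a) ` ?R"
  proof (intro equalityI subsetI)
    fix g assume "g \<in> ?M"
    then show "g \<in> (\<lambda>(a, b). monomial a) ` ?R"
      unfolding var_def monomial_mult
      by (elim UnE CollectE exE conjE) (hypsubst, rule in_M, rule relations.intros, assumption+)+
  next
    fix g :: "(tvar, 'k) mpoly" assume "g \<in> (\<lambda>(a, b). monomial a) ` ?R"
    then obtain a b where "(a, b) \<in> ?R" "g = monomial a" by auto
    then show "g \<in> ?M"
      unfolding var_def monomial_mult by cases blast+
  qed
  have J: "?J \<subseteq> carrier (pring (tvars p q r))"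
    by (auto simp: toric_ideal_def a_kernel_def')
  have binomial: "monomial a - monomial b \<in> ?J" if ab: "(a, b) \<in> ?R" for a b
  proof -
    have "a \<noteq> b" using relations_tless[OF ab] tless_irrefl by blast
    then show ?thesis
      using relations_over_tvars[OF ab assms(2,3)] relations_pi_mon[OF ab assms(2,3), where 'k = 'k]
      by (auto simp: binomial_in_toric_ideal_iff in_pring_iff keys_binomial)
  qed
  have divides: "\<exists>(a, b)\<in>?R. \<exists>l. lead_mon tless f = a + l" if "f \<in> ?J" "f \<noteq> 0" for f
    using toric_lead_mon_not_standard[OF assms(2,3) that] unfolding standard_def by blast
  have basis: "groebner_basis (tvars p q r) tless ?J ?B"
    by (rule tless.groebner_basis_of_binomials(1)[OF J finite_relations])
      (rule relations_tless binomial divides; assumption)+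
  have init: "initial_ideal (tvars p q r) tless ?J = Idl\<^bsub>pring (tvars p q r)\<^esub> ((\<lambda>(a, b). monomial a) ` ?R)"
    by (rule tless.groebner_basis_of_binomials(2)[OF J finite_relations])
      (rule relations_tless binomial divides; assumption)+
  have reduced: "\<forall>g\<in>?B. \<forall>g'\<in>?B. g \<noteq> g' \<longrightarrow>
      (\<forall>m\<in>Poly_Mapping.keys g'. \<not> (\<exists>l. m = lead_mon tless g + l))"
  proof (clarify)
    fix a b a' b' m l
    assume ab: "(a, b) \<in> ?R" "(a', b') \<in> ?R"
      and neq: "monomial a - monomial b \<noteq> (monomial a' - monomial b' :: (tvar, 'k) mpoly)"
      and m: "lead_mon tless (monomial a - monomial b :: (tvar, 'k) mpoly) + l
        \<in> Poly_Mapping.keys (monomial a' - monomial b' :: (tvar, 'k) mpoly)"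
    have "a' \<noteq> b'" using relations_tless[OF ab(2)] tless_irrefl by blast
    then have "a + l = a' \<or> a + l = b'"
      using m by (simp add: keys_binomial tless.lead_mon_binomial[OF relations_tless[OF ab(1)]])
    then have "(a, b) = (a', b')" by (rule relations_reduced[OF ab])
    with neq show False by simp
  qed
  have monic: "\<forall>g\<in>?B. Poly_Mapping.lookup g (lead_mon tless g) = 1"
  proof (clarify)
    fix a b assume ab: "(a, b) \<in> ?R"
    have "a \<noteq> b" using relations_tless[OF ab] tless_irrefl by blast
    then show "Poly_Mapping.lookup (monomial a - monomial b :: (tvar, 'k) mpoly)
        (lead_mon tless (monomial a - monomial b :: (tvar, 'k) mpoly)) = 1"
      by (simp add: lookup_binomial tless.lead_mon_binomial[OF relations_tless[OF ab]])
  qed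
  show ?thesis
    unfolding G M reduced_groebner_basis_def by (intro conjI basis init reduced monic)
qed

end
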